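(* Let $(f_j)_{j\ge1}$ be an orthonormal system in $L^2(\mathbf T)$ with $\sum_{k\in\mathbb Z}|\mathscr F_xf_j(k)|^2=1$, $(\lambda_j)_j\in\ell^2$, $\gamma_0=\sum_j\lambda_j|f_j\rangle\langle f_j|$ (so $\|\gamma_0\|_{\mathfrak S^2}=(\sum_j|\lambda_j|^2)^{1/2}$), and let $f_j^\omega=\sum_{k\in\mathbb Z}g_k^{(1)}(\omega)e^{ixk}\mathscr F_xf_j(k)$. Fix $x\in\mathbf T$ and put $$F(t,\omega,\tilde\omega)=\sum_{j=1}^\infty\lambda_jg_j^{(2)}(\tilde\omega)\Big(|f_j^\omega(x)|^2-\big|e^{it\sqrt{\partial_x^4-\partial_x^2}}f_j^\omega(x)\big|^2\Big).$$ Then there is $C>0$ such that for every $\epsilon\in(0,1)$ there exists $\delta>0$ such that for all $|t|<\delta$ and all $r\in[2,\infty)$, $$\|F(t,\cdot,\cdot)\|_{L^r_{\omega,\tilde\omega}(\Omega\times\tilde\Omega)}\le Cr^{3/2}\epsilon^2(\|\gamma_0\|_{\mathfrak S^2}+1),$$ and moreover $$\lim_{t\to0}(\mathbb P\times\tilde{\mathbb P})\big(\{(\omega,\tilde\omega):|F(t,\omega,\tilde\omega)|>C\alpha_2\}\big)=0,\qquad \alpha_2=(\|\gamma_0\|_{\mathfrak S^2}+1)\,e\,\epsilon^{1/2}\big(\epsilon\ln\tfrac1\epsilon\big)^{3/2}.$$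
   Context: $\mathbf T=[0,2\pi)$, $\mathscr F_xf(k)=\frac1{2\pi}\int_{\mathbf T}e^{-ixk}f(x)dx$; on $\mathbf T$, $e^{it\sqrt{\partial_x^4-\partial_x^2}}$ multiplies the $k$-th Fourier coefficient by $e^{it\sqrt{k^4+k^2}}$. $(g_k^{(1)})_{k\in\mathbb Z}$ are independent, zero-mean, real random variables on $(\Omega,\mathcal A,\mathbb P)$ and $(g_j^{(2)})_{j\ge1}$ independent, zero-mean, real random variables on $(\tilde\Omega,\tilde{\mathcal A},\tilde{\mathbb P})$, whose distributions $\mu$ all satisfy $|\int e^{\gamma x}d\mu(x)|\le e^{c\gamma^2}$ for all $\gamma\in\mathbb{R}$, with fixed $c>0$. $L^r(\Omega\times\tilde\Omega)$ is with respect to $\mathbb P\times\tilde{\mathbb P}$. *)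

theory Defs
  imports "HOL-Probability.Probability"
begin

definition lim0 :: "(nat \<Rightarrow> complex) \<Rightarrow> complex" where
  "lim0 X = (if convergent X then lim X else 0)"

definition fourier_coeff :: "(real \<Rightarrow> complex) \<Rightarrow> int \<Rightarrow> complex" where
  "fourier_coeff f k =
     (LINT y:{0..<2*pi}|lborel. cis (- y * of_int k) * f y) / complex_of_real (2*pi)"

definition inner_T :: "(real \<Rightarrow> complex) \<Rightarrow> (real \<Rightarrow> complex) \<Rightarrow> complex" where
  "inner_T f h = (LINT y:{0..<2*pi}|lborel. f y * cnj (h y)) / complex_of_real (2*pi)"

text \<open>Value at x of e^{it sqrt(d^4 - d^2)} applied to the randomised function
  sum_k g_k(omega) e^{ixk} hat f(k); the series over k in Z is taken as the limit of
  the symmetric partial sums (value 0 if it diverges).\<close>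
definition rand_prop :: "(int \<Rightarrow> 'a \<Rightarrow> real) \<Rightarrow> (real \<Rightarrow> complex) \<Rightarrow> real \<Rightarrow> real \<Rightarrow> 'a \<Rightarrow> complex" where
  "rand_prop g f t x \<omega> =
     lim0 (\<lambda>N. \<Sum>k\<in>{- int N..int N}.
        complex_of_real (g k \<omega>) * cis (x * of_int k)
          * cis (t * sqrt (of_int k ^ 4 + of_int k ^ 2)) * fourier_coeff f k)"

definition series0 :: "(nat \<Rightarrow> complex) \<Rightarrow> complex" where
  "series0 a = lim0 (\<lambda>n. \<Sum>j<n. a j)"

end

theory Submission
  imports Defs
begin

text \<open>
  A finite sum \<open>X = \<Sum> a\<^sub>i g\<^sub>i\<close> of independent subgaussian variables has
  \<open>E exp (\<gamma> X) \<le> exp (c \<gamma>\<^sup>2 s\<^sup>2)\<close> with \<open>s\<^sup>2 = \<Sum> a\<^sub>i\<^sup>2\<close>; as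
  \<open>y\<^sup>r \<le> (r / (e b))\<^sup>r exp (b y)\<close>, the choice \<open>b = \<surd>r / s\<close> bounds its \<open>L\<^sup>r\<close> norm by
  \<open>O(\<surd>r s)\<close>. Fatou's lemma carries this over to series. Writing \<open>A\<^sub>j\<close>, \<open>B\<^sub>j\<close> for the values at
  \<open>x\<close> of the \<open>j\<close>-th randomised function at times \<open>0\<close> and \<open>t\<close>, the estimate
  \<open>| |A\<^sub>j|\<^sup>2 - |B\<^sub>j|\<^sup>2 | \<le> (|A\<^sub>j| + |B\<^sub>j|) |A\<^sub>j - B\<^sub>j|\<close> shows that this difference has \<open>L\<^sup>r\<close> norm
  \<open>O(r H\<^sub>j)\<close> as soon as \<open>H\<^sub>j\<^sup>2\<close> dominates the sum of
  \<open>|f\<^sub>j^(k)|\<^sup>2 |1 - exp (i t \<phi>(k))|\<^sup>2\<close> over \<open>k\<close>. This needs both series to converge almost surely,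
  which follows from Kolmogorov's maximal inequality. The
  subgaussian bound in the second variable and Jensen's inequality then give an \<open>L\<^sup>r\<close> norm of
  order \<open>r\<^bsup>3/2\<^esup> (\<Sum> |\<lambda>\<^sub>j|\<^sup>2 H\<^sub>j\<^sup>2)\<^bsup>1/2\<^esup>\<close>. For small \<open>t\<close> one may take \<open>H\<^sub>j = \<epsilon>\<^sup>2\<close> for
  finitely many \<open>j\<close> and \<open>H\<^sub>j = 2\<close> for the others, where the tail of \<open>|\<lambda>\<^sub>j|\<^sup>2\<close> is small.
  The limit in probability follows from the case \<open>r = 2\<close> by Chebyshev's inequality.
\<close>

section \<open>Almost sure convergence of series of independent variables\<close>

text \<open>Injectivity makes the singletons \<open>{h j}\<close> disjoint, and restrictions to
  disjoint index blocks are independent.\<close>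

lemma (in prob_space) indep_vars_reindex_inj:
  assumes ind: "indep_vars M' X I" and inj: "inj_on h L" and sub: "h ` L \<subseteq> I"
  shows "indep_vars (\<lambda>j. M' (h j)) (\<lambda>j. X (h j)) L"
proof -
  have "indep_vars (\<lambda>j. PiM {h j} M') (\<lambda>j \<omega>. restrict (\<lambda>i. X i \<omega>) {h j}) L"
    using inj sub by (intro indep_vars_restrict[OF ind]) (auto simp: disjoint_family_on_def inj_on_def)
  then have "indep_vars (\<lambda>j. M' (h j)) (\<lambda>j \<omega>. (\<lambda>u. u (h j)) (restrict (\<lambda>i. X i \<omega>) {h j})) L"
    by (rule indep_vars_compose2) (rule measurable_component_singleton, simp)
  then show ?thesis by simp
qed

text \<open>The sum is frozen when a partial sum first exceeds \<open>l\<close>; independence makes the increments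
  of the frozen sum orthogonal.\<close>
lemma (in prob_space) kolmogorov_maximal_inequality:
  fixes X :: "nat \<Rightarrow> 'a \<Rightarrow> real"
  assumes ind: "indep_vars (\<lambda>_. borel) X UNIV"
    and sq: "\<And>n. integrable M (\<lambda>\<omega>. (X n \<omega>)\<^sup>2)"
    and mean: "\<And>n. expectation (X n) = 0"
    and l: "l > 0"
  shows "prob {\<omega>\<in>space M. \<exists>k\<le>n. l < \<bar>\<Sum>i<k. X i \<omega>\<bar>} \<le> (\<Sum>i<n. expectation (\<lambda>\<omega>. (X i \<omega>)\<^sup>2)) / l\<^sup>2"
proof -
  have [measurable]: "X i \<in> borel_measurable M" for i
    using ind by (auto simp: indep_vars_def)
  \<comment> \<open>\<open>z n\<close> is 1 as long as no partial sum has exceeded \<open>l\<close>.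
    It looks at sums of at most \<open>n\<close> terms, that is at coordinates below
    \<open>n\<close>, so it is independent of the increment \<open>X n\<close> that it multiplies in
    \<open>T\<close>.\<close>
  define z where "z n u = (if \<forall>k\<in>{..n}. \<bar>\<Sum>i<k. u i\<bar> \<le> l then 1 else (0::real))" for n and u :: "nat \<Rightarrow> real"
  define T where "T n u = (\<Sum>k<n. z k u * u k)" for n and u :: "nat \<Rightarrow> real"
  have z_idem: "z n u * z n u = z n u" for n u by (auto simp: z_def)
  have zm: "z k \<in> borel_measurable (PiM {..<n} (\<lambda>_. borel))" if "k \<le> n" for k n
  proof -
    have "(\<lambda>u. \<Sum>i<m. u i) \<in> borel_measurable (PiM {..<n} (\<lambda>_. borel::real measure))" if "m \<le> k" for m
      using that \<open>k \<le> n\<close> by (intro borel_measurable_sum measurable_component_singleton) auto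
    then have "Measurable.pred (PiM {..<n} (\<lambda>_. borel)) (\<lambda>u. \<bar>\<Sum>i<m. u i\<bar> \<le> l)" if "m \<in> {..k}" for m
      using that by simp
    then have "Measurable.pred (PiM {..<n} (\<lambda>_. borel)) (\<lambda>u. \<forall>m\<in>{..k}. \<bar>\<Sum>i<m. u i\<bar> \<le> l)"
      by (intro pred_intros_finite) auto
    then show ?thesis unfolding z_def by measurable
  qed
  have Tm: "T n \<in> borel_measurable (PiM {..<n} (\<lambda>_. borel))" for n
    unfolding T_def
    by (intro borel_measurable_sum borel_measurable_times zm measurable_component_singleton) auto
  have zr: "z k (restrict u {..<n}) = z k u" if "k \<le> n" for k n u
  proof -
    have "(\<Sum>i<m. restrict u {..<n} i) = (\<Sum>i<m. u i)" if "m \<le> k" for m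
      using that \<open>k \<le> n\<close> by (intro sum.cong) auto
    then show ?thesis by (auto simp: z_def)
  qed
  have Tr: "T n (restrict u {..<n}) = T n u" for n u
    unfolding T_def by (intro sum.cong) (auto simp: zr)
  have rm: "(\<lambda>\<omega>. restrict (\<lambda>i. X i \<omega>) {..<n}) \<in> measurable M (PiM {..<n} (\<lambda>_. borel))" for n
    by (intro measurable_restrict) auto
  have "(\<lambda>\<omega>. z n (restrict (\<lambda>i. X i \<omega>) {..<n})) \<in> borel_measurable M" for n
    by (rule measurable_compose[OF rm zm]) (rule order_refl)
  then have zM: "(\<lambda>\<omega>. z n (\<lambda>i. X i \<omega>)) \<in> borel_measurable M" for n
    unfolding zr[OF order_refl] .
  have "(\<lambda>\<omega>. T n (restrict (\<lambda>i. X i \<omega>) {..<n})) \<in> borel_measurable M" for n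
    by (rule measurable_compose[OF rm Tm])
  then have TM: "(\<lambda>\<omega>. T n (\<lambda>i. X i \<omega>)) \<in> borel_measurable M" for n
    unfolding Tr .
  have Xint: "integrable M (X n)" for n
    by (rule square_integrable_imp_integrable[OF _ sq]) measurable
  \<comment> \<open>Coordinate \<open>n\<close> and the coordinates below \<open>n\<close> are
    disjoint blocks, so the expectation factorises and the zero mean of \<open>X n\<close> kills
    it.\<close>
  have orth: "integrable M (\<lambda>\<omega>. X n \<omega> * (T n (\<lambda>i. X i \<omega>) * z n (\<lambda>i. X i \<omega>)))
     \<and> expectation (\<lambda>\<omega>. X n \<omega> * (T n (\<lambda>i. X i \<omega>) * z n (\<lambda>i. X i \<omega>))) = 0"
    if "integrable M (\<lambda>\<omega>. (T n (\<lambda>i. X i \<omega>))\<^sup>2)" for n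
  proof -
    have "indep_var borel ((\<lambda>u. u n) \<circ> (\<lambda>\<omega>. restrict (\<lambda>i. X i \<omega>) {n}))
       borel ((\<lambda>u. T n u * z n u) \<circ> (\<lambda>\<omega>. restrict (\<lambda>i. X i \<omega>) {..<n}))"
      by (intro indep_var_compose[OF indep_var_restrict[OF ind]] borel_measurable_times Tm zm) auto
    also have "((\<lambda>u. u n) \<circ> (\<lambda>\<omega>. restrict (\<lambda>i. X i \<omega>) {n})) = X n" by auto
    also have "((\<lambda>u. T n u * z n u) \<circ> (\<lambda>\<omega>. restrict (\<lambda>i. X i \<omega>) {..<n}))
       = (\<lambda>\<omega>. T n (\<lambda>i. X i \<omega>) * z n (\<lambda>i. X i \<omega>))" by (auto simp: Tr zr fun_eq_iff)
    finally have iv: "indep_var borel (X n) borel (\<lambda>\<omega>. T n (\<lambda>i. X i \<omega>) * z n (\<lambda>i. X i \<omega>))" .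
    have "integrable M (\<lambda>\<omega>. T n (\<lambda>i. X i \<omega>))"
      by (rule square_integrable_imp_integrable[OF TM that])
    then have "integrable M (\<lambda>\<omega>. T n (\<lambda>i. X i \<omega>) * z n (\<lambda>i. X i \<omega>))"
      by (rule Bochner_Integration.integrable_bound[OF _ borel_measurable_times[OF TM zM]])
        (auto simp: z_def)
    then show ?thesis
      using indep_var_integrable[OF iv Xint] indep_var_lebesgue_integral[OF iv Xint] mean by auto
  qed
  \<comment> \<open>As \<open>z n\<close> is idempotent, the squared increment keeps a single factor
    \<open>z n\<close>, which is then bounded by 1.\<close>
  have step: "(T (Suc n) u)\<^sup>2 = (T n u)\<^sup>2 + 2 * (u n * (T n u * z n u)) + z n u * (u n)\<^sup>2" for n u
    using z_idem[of n u] by (simp add: T_def power2_eq_square algebra_simps)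
  have main: "integrable M (\<lambda>\<omega>. (T n (\<lambda>i. X i \<omega>))\<^sup>2) \<and>
    expectation (\<lambda>\<omega>. (T n (\<lambda>i. X i \<omega>))\<^sup>2) \<le> (\<Sum>i<n. expectation (\<lambda>\<omega>. (X i \<omega>)\<^sup>2))" for n
  proof (induction n)
    case 0
    show ?case by (simp add: T_def)
  next
    case (Suc n)
    have i3: "integrable M (\<lambda>\<omega>. z n (\<lambda>i. X i \<omega>) * (X n \<omega>)\<^sup>2)"
      by (rule Bochner_Integration.integrable_bound[OF sq[of n] borel_measurable_times[OF zM]])
        (auto simp: z_def)
    have "expectation (\<lambda>\<omega>. z n (\<lambda>i. X i \<omega>) * (X n \<omega>)\<^sup>2) \<le> expectation (\<lambda>\<omega>. (X n \<omega>)\<^sup>2)"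
      using i3 sq by (intro integral_mono) (auto simp: z_def)
    with Suc orth[of n] i3 show ?case unfolding step by simp
  qed
  have stop: "l < \<bar>T n u\<bar>" if "k \<le> n" "l < \<bar>\<Sum>i<k. u i\<bar>" for k n u
  proof -
    define m where "m = (LEAST k. l < \<bar>\<Sum>i<k. u i\<bar>)"
    have m: "l < \<bar>\<Sum>i<m. u i\<bar>" unfolding m_def by (rule LeastI) (fact that(2))
    have mk: "m \<le> k" unfolding m_def by (rule Least_le) (fact that(2))
    have zl: "z j u = (if j < m then 1 else 0)" for j
    proof (cases "j < m")
      case True
      have "\<not> l < \<bar>\<Sum>i<i'. u i\<bar>" if "i' \<le> j" for i'
        using that True not_less_Least[of i' "\<lambda>k. l < \<bar>\<Sum>i<k. u i\<bar>"] unfolding m_def by auto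
      then show ?thesis using True by (force simp: z_def)
    next
      case False
      then show ?thesis using m by (auto simp: z_def not_less intro!: bexI[of _ m])
    qed
    have "T n u = (\<Sum>j<n. if j < m then u j else 0)" unfolding T_def by (intro sum.cong) (auto simp: zl)
    also have "\<dots> = (\<Sum>j\<in>{..<m}. u j)"
      using mk that(1) by (intro sum.mono_neutral_cong_right) auto
    finally show ?thesis using m by simp
  qed
  have "prob {\<omega>\<in>space M. \<exists>k\<le>n. l < \<bar>\<Sum>i<k. X i \<omega>\<bar>} \<le> prob {\<omega>\<in>space M. l \<le> \<bar>T n (\<lambda>i. X i \<omega>)\<bar>}"
    using TM[of n, measurable] by (intro finite_measure_mono) (auto dest: stop less_imp_le)
  also have "\<dots> \<le> expectation (\<lambda>\<omega>. (T n (\<lambda>i. X i \<omega>))\<^sup>2) / l\<^sup>2"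
    using main[of n] l by (intro second_moment_method TM) auto
  also have "\<dots> \<le> (\<Sum>i<n. expectation (\<lambda>\<omega>. (X i \<omega>)\<^sup>2)) / l\<^sup>2"
    using main[of n] by (intro divide_right_mono) auto
  finally show ?thesis .
qed

text \<open>For the sequence shifted by \<open>m\<close>, the maximal inequality bounds the
  probability of a later deviation above \<open>l\<close> by a tail of the variances. The tail
  vanishes as \<open>m\<close> grows, which makes the partial sums almost surely Cauchy.\<close>

lemma (in prob_space) AE_convergent_sum_indep:
  fixes X :: "nat \<Rightarrow> 'a \<Rightarrow> real"
  assumes ind: "indep_vars (\<lambda>_. borel) X UNIV"
    and sq: "\<And>n. integrable M (\<lambda>\<omega>. (X n \<omega>)\<^sup>2)"
    and mean: "\<And>n. expectation (X n) = 0"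
    and summ: "summable (\<lambda>n. expectation (\<lambda>\<omega>. (X n \<omega>)\<^sup>2))"
  shows "AE \<omega> in M. convergent (\<lambda>n. \<Sum>i<n. X i \<omega>)"
proof -
  have [measurable]: "X i \<in> borel_measurable M" for i
    using ind by (auto simp: indep_vars_def)
  let ?v = "\<lambda>n. expectation (\<lambda>\<omega>. (X n \<omega>)\<^sup>2)"
  define E where "E l m = {\<omega>\<in>space M. \<exists>k. l < \<bar>\<Sum>i<k. X (i + m) \<omega>\<bar>}" for l m
  have Em[measurable]: "E l m \<in> sets M" for l m unfolding E_def by measurable
  have bound: "prob (E l m) \<le> (\<Sum>n. ?v (n + m)) / l\<^sup>2" if "l > 0" for l m
  proof -
    let ?A = "\<lambda>n. {\<omega>\<in>space M. \<exists>k\<le>n. l < \<bar>\<Sum>i<k. X (i + m) \<omega>\<bar>}"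
    have "(\<lambda>n. prob (?A n)) \<longlonglongrightarrow> prob (\<Union>n. ?A n)"
      by (intro finite_Lim_measure_incseq) (auto simp: incseq_def intro: order_trans)
    also have "(\<Union>n. ?A n) = E l m" by (auto simp: E_def)
    finally have lim: "(\<lambda>n. prob (?A n)) \<longlonglongrightarrow> prob (E l m)" .
    have "indep_vars (\<lambda>_. borel) (\<lambda>i. X (i + m)) UNIV"
      by (rule indep_vars_reindex_inj[OF ind]) (auto simp: inj_on_def)
    from kolmogorov_maximal_inequality[OF this sq mean that]
    have "prob (?A n) \<le> (\<Sum>i<n. ?v (i + m)) / l\<^sup>2" for n .
    also have "(\<Sum>i<n. ?v (i + m)) / l\<^sup>2 \<le> (\<Sum>n. ?v (n + m)) / l\<^sup>2" for n
      using summable_ignore_initial_segment[OF summ, of m]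
      by (intro divide_right_mono sum_le_suminf) auto
    finally show ?thesis by (intro LIMSEQ_le_const2[OF lim]) auto
  qed
  have "AE \<omega> in M. \<exists>m. \<omega> \<notin> E l m" if "l > 0" for l
  proof -
    have "(\<lambda>m. (\<Sum>n. ?v (n + m)) / l\<^sup>2) \<longlonglongrightarrow> 0 / l\<^sup>2"
      by (intro tendsto_intros suminf_exist_split2 summ) (use that in auto)
    \<comment> \<open>The intersection lies in every \<open>E l m\<close>, so its probability is
      below every term of a null sequence.\<close>
    then have "prob (\<Inter>m. E l m) \<le> 0 / l\<^sup>2"
      by (rule LIMSEQ_le_const) (auto intro!: exI[of _ 0] order_trans[OF finite_measure_mono bound] that)
    then have "prob (\<Inter>m. E l m) = 0" by (simp add: measure_le_0_iff)
    then have "AE \<omega> in M. \<omega> \<notin> (\<Inter>m. E l m)" by (subst prob_eq_0[symmetric]) auto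
    then show ?thesis by auto
  qed
  \<comment> \<open>Countably many thresholds suffice, so the exceptional null sets can be
    united.\<close>
  then have "AE \<omega> in M. \<forall>p. \<exists>m. \<omega> \<notin> E (inverse (real (Suc p))) m"
    by (subst AE_all_countable) auto
  with AE_space show ?thesis
  proof eventually_elim
    case (elim \<omega>)
    note wsp = elim(1)
    have "Cauchy (\<lambda>n. \<Sum>i<n. X i \<omega>)"
    proof (rule metric_CauchyI)
      fix e :: real assume "e > 0"
      then obtain p where p: "inverse (real (Suc p)) < e / 2"
        using reals_Archimedean[of "e/2"] by auto
      from elim obtain m where "\<omega> \<notin> E (inverse (real (Suc p))) m" by auto
      then have m: "\<bar>\<Sum>i<k. X (i + m) \<omega>\<bar> \<le> inverse (real (Suc p))" for k
        using wsp by (force simp: E_def not_less)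
      have split: "(\<Sum>i<k + m. X i \<omega>) = (\<Sum>i<m. X i \<omega>) + (\<Sum>i<k. X (i + m) \<omega>)" for k
        by (induction k) auto
      have near: "\<bar>(\<Sum>i<n. X i \<omega>) - (\<Sum>i<m. X i \<omega>)\<bar> < e / 2" if "n \<ge> m" for n
        using split[of "n - m"] m[of "n - m"] p that by simp
      show "\<exists>N. \<forall>n\<ge>N. \<forall>k\<ge>N. dist (\<Sum>i<n. X i \<omega>) (\<Sum>i<k. X i \<omega>) < e"
      proof (intro exI[of _ m] allI impI)
        fix n k assume "m \<le> n" "m \<le> k"
        then show "dist (\<Sum>i<n. X i \<omega>) (\<Sum>i<k. X i \<omega>) < e"
          using near[of n] near[of k] unfolding dist_real_def by linarith
      qed
    qed
    then show ?case by (simp add: Cauchy_convergent_iff)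
  qed
qed

section \<open>Elementary inequalities for real powers\<close>

text \<open>The constant is the maximum of \<open>y powr r * exp (- a * y)\<close>, attained at
  \<open>y = r / a\<close>. The bound is \<open>ln v \<le> v - 1\<close> at
  \<open>v = a * y / r\<close>.\<close>

lemma powr_le_exp:
  fixes y r a :: real
  assumes "0 \<le> y" "0 < r" "0 < a"
  shows "y powr r \<le> (r / (exp 1 * a)) powr r * exp (a * y)"
proof (cases "y = 0")
  case False
  with assms have y: "y > 0" by simp
  have "ln (a * y / r) \<le> a * y / r - 1" using assms y by (intro ln_le_minus_one) simp
  then have "r * ln (a * y / r) \<le> a * y - r" using assms by (simp add: field_simps)
  then have "r * ln y \<le> r * ln (r / (exp 1 * a)) + a * y"
    using assms y by (simp add: ln_mult ln_div algebra_simps)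
  then have "exp (r * ln y) \<le> exp (r * ln (r / (exp 1 * a)) + a * y)" by simp
  then show ?thesis using assms y by (simp add: powr_def exp_add)
qed simp

lemma powr_add_le:
  fixes u v r :: real
  assumes "0 \<le> u" "0 \<le> v" "0 \<le> r"
  shows "(u + v) powr r \<le> 2 powr r * (u powr r + v powr r)"
proof -
  have "(u + v) powr r \<le> (2 * max u v) powr r" using assms by (intro powr_mono2) auto
  also have "\<dots> = 2 powr r * max u v powr r" using assms by (simp add: powr_mult)
  also have "\<dots> \<le> 2 powr r * (u powr r + v powr r)" by (intro mult_left_mono) (auto simp: max_def)
  finally show ?thesis .
qed

text \<open>This absorbs numerical factors into the base of an \<open>r\<close>-th power, which
  keeps the later constants uniform in \<open>r\<close>.\<close>

lemma le_powr_of_one_le: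
  fixes a r :: real
  assumes "1 \<le> a" "1 \<le> r"
  shows "a \<le> a powr r"
  using powr_mono[of 1 r a] assms by simp

section \<open>Moments and convergence of subgaussian series\<close>

text \<open>The index type is left open because one family is indexed by integers and the other by
  naturals. As a nonnegative integral the exponential bound includes finiteness.\<close>

locale indep_subgaussian = prob_space M for M :: "'a measure" +
  fixes g :: "'i \<Rightarrow> 'a \<Rightarrow> real" and c :: real
  assumes c_nonneg: "0 \<le> c"
    and indep: "indep_vars (\<lambda>_. borel) g UNIV"
    and mean_zero: "\<And>k. expectation (g k) = 0"
    and mgf_le: "\<And>k \<gamma>. (\<integral>\<^sup>+ \<omega>. ennreal (exp (\<gamma> * g k \<omega>)) \<partial>M) \<le> ennreal (exp (c * \<gamma>\<^sup>2))"
begin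

lemma g_measurable [measurable]: "g k \<in> borel_measurable M"
  using indep by (auto simp: indep_vars_def)

lemma sum_mgf_le:
  assumes "finite I"
  shows "(\<integral>\<^sup>+ \<omega>. ennreal (exp (\<gamma> * (\<Sum>i\<in>I. g i \<omega> * a i))) \<partial>M) \<le> ennreal (exp (c * \<gamma>\<^sup>2 * (\<Sum>i\<in>I. (a i)\<^sup>2)))"
proof -
  have ind: "indep_vars (\<lambda>_. borel) (\<lambda>i \<omega>. ennreal (exp (\<gamma> * a i * g i \<omega>))) I"
    by (rule indep_vars_compose2[OF indep_vars_subset[OF indep], where Y="\<lambda>i x. ennreal (exp (\<gamma> * a i * x))"]) auto
  have "(\<integral>\<^sup>+ \<omega>. ennreal (exp (\<gamma> * (\<Sum>i\<in>I. g i \<omega> * a i))) \<partial>M)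
      = (\<integral>\<^sup>+ \<omega>. (\<Prod>i\<in>I. ennreal (exp (\<gamma> * a i * g i \<omega>))) \<partial>M)"
    by (intro nn_integral_cong)
       (simp add: sum_distrib_left exp_sum[OF assms] prod_ennreal mult_ac)
  also have "\<dots> = (\<Prod>i\<in>I. \<integral>\<^sup>+ \<omega>. ennreal (exp (\<gamma> * a i * g i \<omega>)) \<partial>M)"
    by (rule indep_vars_nn_integral[OF assms ind]) simp
  also have "\<dots> \<le> (\<Prod>i\<in>I. ennreal (exp (c * (\<gamma> * a i)\<^sup>2)))"
    using assms by (induction I) (auto intro!: mult_mono mgf_le)
  also have "\<dots> = ennreal (exp (c * \<gamma>\<^sup>2 * (\<Sum>i\<in>I. (a i)\<^sup>2)))"
    by (simp add: prod_ennreal exp_sum[OF assms] sum_distrib_left power_mult_distrib mult_ac)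
  finally show ?thesis .
qed

text \<open>\<open>s\<close> is only an upper bound for the l2 norm of the coefficients, so that one
  estimate serves all partial sums of a series.\<close>

lemma real_sum_moment_le:
  assumes I: "finite I" and s: "0 \<le> s" "(\<Sum>i\<in>I. (a i)\<^sup>2) \<le> s\<^sup>2" and r: "1 \<le> r"
  shows "(\<integral>\<^sup>+ \<omega>. ennreal (\<bar>\<Sum>i\<in>I. g i \<omega> * a i\<bar> powr r) \<partial>M) \<le> ennreal ((2 * exp c * sqrt r * s) powr r)"
proof (cases "s = 0")
  \<comment> \<open>All coefficients vanish here; the case is split off because \<open>b\<close>
    below divides by \<open>s\<close>.\<close>
  case True
  have "(\<Sum>i\<in>I. (a i)\<^sup>2) = 0" using s(2) True by (intro antisym sum_nonneg) auto
  then have "\<forall>i\<in>I. a i = 0" using I by (simp add: sum_nonneg_eq_0_iff)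
  then show ?thesis by simp
next
  case False
  with s have s: "0 < s" "(\<Sum>i\<in>I. (a i)\<^sup>2) \<le> s\<^sup>2" by auto
  let ?X = "\<lambda>\<omega>. \<Sum>i\<in>I. g i \<omega> * a i"
  define b where "b = sqrt r / s"
  have b: "b > 0" using s r by (simp add: b_def)
  \<comment> \<open>This covers both signs \<open>b\<close> and \<open>- b\<close>, since the
    exponential of \<open>b * \<bar>?X \<omega>\<bar>\<close> is at most the sum of the two. The
    choice of \<open>b\<close> turns the exponent into \<open>c * r\<close>.\<close>
  have mgf: "(\<integral>\<^sup>+ \<omega>. ennreal (exp (\<gamma> * ?X \<omega>)) \<partial>M) \<le> ennreal (exp (c * r))" if "\<gamma>\<^sup>2 = b\<^sup>2" for \<gamma>
  proof -
    have "c * b\<^sup>2 * (\<Sum>i\<in>I. (a i)\<^sup>2) \<le> c * b\<^sup>2 * s\<^sup>2" using s c_nonneg by (intro mult_left_mono) auto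
    also have "\<dots> = c * r" using s r by (simp add: b_def power_divide)
    finally have "ennreal (exp (c * \<gamma>\<^sup>2 * (\<Sum>i\<in>I. (a i)\<^sup>2))) \<le> ennreal (exp (c * r))"
      using that by (intro ennreal_leI) simp
    with sum_mgf_le[OF I, of \<gamma> a] show ?thesis by (rule order_trans)
  qed
  let ?q = "(r / (exp 1 * b)) powr r"
  have "\<bar>?X \<omega>\<bar> powr r \<le> ?q * (exp (b * ?X \<omega>) + exp (- b * ?X \<omega>))" for \<omega>
  proof -
    have "\<bar>?X \<omega>\<bar> powr r \<le> ?q * exp (b * \<bar>?X \<omega>\<bar>)" using r b by (intro powr_le_exp) auto
    also have "\<dots> \<le> ?q * (exp (b * ?X \<omega>) + exp (- b * ?X \<omega>))"
      by (intro mult_left_mono) (auto simp: abs_if)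
    finally show ?thesis .
  qed
  then have "(\<integral>\<^sup>+ \<omega>. ennreal (\<bar>?X \<omega>\<bar> powr r) \<partial>M)
      \<le> (\<integral>\<^sup>+ \<omega>. ennreal ?q * (ennreal (exp (b * ?X \<omega>)) + ennreal (exp (- b * ?X \<omega>))) \<partial>M)"
    by (intro nn_integral_mono) (simp add: ennreal_mult[symmetric] ennreal_plus[symmetric] del: ennreal_plus)
  also have "\<dots> = ennreal ?q * ((\<integral>\<^sup>+ \<omega>. ennreal (exp (b * ?X \<omega>)) \<partial>M) + (\<integral>\<^sup>+ \<omega>. ennreal (exp (- b * ?X \<omega>)) \<partial>M))"
    by (subst nn_integral_cmult) (auto simp: nn_integral_add)
  also have "\<dots> \<le> ennreal ?q * (ennreal (exp (c * r)) + ennreal (exp (c * r)))"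
    by (intro mult_left_mono add_mono mgf) auto
  also have "\<dots> = ennreal (2 * (?q * exp (c * r)))"
    by (simp add: ennreal_mult[symmetric] ennreal_plus[symmetric] del: ennreal_plus)
  also have "2 * (?q * exp (c * r)) \<le> (2 * exp c * sqrt r * s) powr r"
  proof -
    \<comment> \<open>The gain \<open>1 / exp 1\<close> is discarded, and the factor 2 from the two
      signs goes into \<open>2 powr r\<close>.\<close>
    have "r / (exp 1 * b) = sqrt r * s / exp 1"
      using s r by (simp add: b_def field_simps)
    also have "\<dots> \<le> sqrt r * s"
      using s r mult_left_mono[of 1 "exp 1" "sqrt r * s"] by (simp add: divide_le_eq)
    finally have "?q \<le> (sqrt r * s) powr r" using r b by (intro powr_mono2) auto
    moreover have "(2::real) \<le> 2 powr r" using r by (intro le_powr_of_one_le) auto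
    ultimately have "2 * (?q * exp (c * r)) \<le> 2 powr r * ((sqrt r * s) powr r * exp (c * r))"
      by (intro mult_mono) auto
    also have "\<dots> = (2 * exp c * sqrt r * s) powr r"
      using s r by (simp add: powr_mult exp_powr_real mult_ac)
    finally show ?thesis .
  qed
  finally show ?thesis by (simp add: ennreal_leI)
qed

text \<open>The 8 is a product of three twos: the two signs in the exponential bound, the factor in
  \<open>powr_add_le\<close>, and the sum of the bounds for real and imaginary parts.
  \<open>K\<close> depends on \<open>c\<close> alone and so is common to both families.\<close>

definition K :: real where "K = 8 * exp c"

lemma K_pos: "K > 0" by (simp add: K_def)

lemma sum_moment_le:
  fixes a :: "'i \<Rightarrow> complex"
  assumes I: "finite I" and s: "0 \<le> s" "(\<Sum>i\<in>I. (cmod (a i))\<^sup>2) \<le> s\<^sup>2" and r: "1 \<le> r"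
  shows "(\<integral>\<^sup>+ \<omega>. ennreal (cmod (\<Sum>i\<in>I. of_real (g i \<omega>) * a i) powr r) \<partial>M) \<le> ennreal ((K * sqrt r * s) powr r)"
proof -
  let ?R = "\<lambda>\<omega>. \<bar>\<Sum>i\<in>I. g i \<omega> * Re (a i)\<bar>" and ?J = "\<lambda>\<omega>. \<bar>\<Sum>i\<in>I. g i \<omega> * Im (a i)\<bar>"
  let ?B = "(2 * exp c * sqrt r * s) powr r"
  have "(\<Sum>i\<in>I. (Re (a i))\<^sup>2) \<le> (\<Sum>i\<in>I. (cmod (a i))\<^sup>2)" "(\<Sum>i\<in>I. (Im (a i))\<^sup>2) \<le> (\<Sum>i\<in>I. (cmod (a i))\<^sup>2)"
    by (auto intro!: sum_mono simp: cmod_power2)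
  with s have ri: "(\<Sum>i\<in>I. (Re (a i))\<^sup>2) \<le> s\<^sup>2" "(\<Sum>i\<in>I. (Im (a i))\<^sup>2) \<le> s\<^sup>2" by linarith+
  have "cmod (\<Sum>i\<in>I. of_real (g i \<omega>) * a i) powr r \<le> 2 powr r * (?R \<omega> powr r + ?J \<omega> powr r)" for \<omega>
  proof -
    have "cmod (\<Sum>i\<in>I. of_real (g i \<omega>) * a i) \<le> ?R \<omega> + ?J \<omega>"
      using cmod_le[of "\<Sum>i\<in>I. of_real (g i \<omega>) * a i"] by (simp add: Re_sum Im_sum)
    then have "cmod (\<Sum>i\<in>I. of_real (g i \<omega>) * a i) powr r \<le> (?R \<omega> + ?J \<omega>) powr r"
      using r by (intro powr_mono2) auto
    also have "\<dots> \<le> 2 powr r * (?R \<omega> powr r + ?J \<omega> powr r)" using r by (intro powr_add_le) auto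
    finally show ?thesis .
  qed
  then have "(\<integral>\<^sup>+ \<omega>. ennreal (cmod (\<Sum>i\<in>I. of_real (g i \<omega>) * a i) powr r) \<partial>M)
      \<le> (\<integral>\<^sup>+ \<omega>. ennreal (2 powr r) * (ennreal (?R \<omega> powr r) + ennreal (?J \<omega> powr r)) \<partial>M)"
    by (intro nn_integral_mono) (simp add: ennreal_mult[symmetric] ennreal_plus[symmetric] del: ennreal_plus)
  also have "\<dots> = ennreal (2 powr r) * ((\<integral>\<^sup>+ \<omega>. ennreal (?R \<omega> powr r) \<partial>M) + (\<integral>\<^sup>+ \<omega>. ennreal (?J \<omega> powr r) \<partial>M))"
    by (subst nn_integral_cmult) (auto simp: nn_integral_add)
  also have "\<dots> \<le> ennreal (2 powr r) * (ennreal ?B + ennreal ?B)"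
    by (intro mult_left_mono add_mono real_sum_moment_le I s ri r) auto
  also have "\<dots> = ennreal (2 * (2 powr r * ?B))"
    by (simp add: ennreal_mult[symmetric] ennreal_plus[symmetric] del: ennreal_plus)
  also have "2 * (2 powr r * ?B) \<le> 2 powr r * (2 powr r * ?B)"
    using r by (intro mult_right_mono le_powr_of_one_le) auto
  also have "2 powr r * (2 powr r * ?B) = (2 * (2 * (2 * exp c * sqrt r * s))) powr r"
    using s r by (simp only: powr_mult)
  also have "2 * (2 * (2 * exp c * sqrt r * s)) = K * sqrt r * s" by (simp add: K_def)
  finally show ?thesis by (simp add: ennreal_leI)
qed

lemma square_integrable: "integrable M (\<lambda>\<omega>. (g k \<omega>)\<^sup>2)"
  and second_moment_le: "expectation (\<lambda>\<omega>. (g k \<omega>)\<^sup>2) \<le> 2 * K\<^sup>2"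
proof -
  have "(\<integral>\<^sup>+ \<omega>. ennreal ((g k \<omega>)\<^sup>2) \<partial>M) = (\<integral>\<^sup>+ \<omega>. ennreal (cmod (\<Sum>i\<in>{k}. of_real (g i \<omega>) * 1) powr 2) \<partial>M)"
    by (intro nn_integral_cong) (auto simp: powr_numeral)
  also have "\<dots> \<le> ennreal ((K * sqrt 2 * 1) powr 2)" by (rule sum_moment_le) auto
  also have "(K * sqrt 2 * 1) powr 2 = 2 * K\<^sup>2" using K_pos by (simp add: powr_numeral power_mult_distrib)
  finally have b: "(\<integral>\<^sup>+ \<omega>. ennreal ((g k \<omega>)\<^sup>2) \<partial>M) \<le> ennreal (2 * K\<^sup>2)" .
  then show i: "integrable M (\<lambda>\<omega>. (g k \<omega>)\<^sup>2)"
    by (intro integrableI_bounded) (auto simp: order_le_less_trans)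
  have "ennreal (expectation (\<lambda>\<omega>. (g k \<omega>)\<^sup>2)) \<le> ennreal (2 * K\<^sup>2)"
    using b nn_integral_eq_integral[OF i] by simp
  then show "expectation (\<lambda>\<omega>. (g k \<omega>)\<^sup>2) \<le> 2 * K\<^sup>2" by simp
qed

text \<open>\<open>h\<close> picks out a sequence of indices, so that the result applies to each
  half of a series over the integers.\<close>

lemma AE_convergent_real_series:
  fixes h :: "nat \<Rightarrow> 'i" and a :: "'i \<Rightarrow> real"
  assumes h: "inj h" and s: "summable (\<lambda>n. (a (h n))\<^sup>2)"
  shows "AE \<omega> in M. convergent (\<lambda>n. \<Sum>i<n. g (h i) \<omega> * a (h i))"
proof (rule AE_convergent_sum_indep)
  have "indep_vars (\<lambda>_. borel) (\<lambda>n. g (h n)) UNIV"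
    by (rule indep_vars_reindex_inj[OF indep h]) auto
  then show "indep_vars (\<lambda>_. borel) (\<lambda>n \<omega>. g (h n) \<omega> * a (h n)) UNIV"
    by (rule indep_vars_compose2[where Y="\<lambda>n x. x * a (h n)"]) auto
  show "integrable M (\<lambda>\<omega>. (g (h n) \<omega> * a (h n))\<^sup>2)" for n
    using square_integrable by (simp add: power_mult_distrib)
  show "expectation (\<lambda>\<omega>. g (h n) \<omega> * a (h n)) = 0" for n using mean_zero by simp
  show "summable (\<lambda>n. expectation (\<lambda>\<omega>. (g (h n) \<omega> * a (h n))\<^sup>2))"
  proof (rule summable_comparison_test'[where N=0])
    show "summable (\<lambda>n. 2 * K\<^sup>2 * (a (h n))\<^sup>2)" using s by (rule summable_mult)
    show "norm (expectation (\<lambda>\<omega>. (g (h n) \<omega> * a (h n))\<^sup>2)) \<le> 2 * K\<^sup>2 * (a (h n))\<^sup>2" for n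
      using second_moment_le[of "h n"] by (auto simp: power_mult_distrib intro!: mult_right_mono)
  qed
qed

lemma AE_convergent_series:
  fixes h :: "nat \<Rightarrow> 'i" and a :: "'i \<Rightarrow> complex"
  assumes h: "inj h" and s: "summable (\<lambda>n. (cmod (a (h n)))\<^sup>2)"
  shows "AE \<omega> in M. convergent (\<lambda>n. \<Sum>i<n. of_real (g (h i) \<omega>) * a (h i))"
proof -
  have "summable (\<lambda>n. (Re (a (h n)))\<^sup>2)" "summable (\<lambda>n. (Im (a (h n)))\<^sup>2)"
    by (rule summable_comparison_test'[OF s, of 0]; simp add: cmod_power2)+
  from this[THEN AE_convergent_real_series[OF h, of "\<lambda>k. _ (a k)"]] show ?thesis
  proof eventually_elim
    case (elim \<omega>)
    then obtain u v where "(\<lambda>n. \<Sum>i<n. g (h i) \<omega> * Re (a (h i))) \<longlonglongrightarrow> u"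
      "(\<lambda>n. \<Sum>i<n. g (h i) \<omega> * Im (a (h i))) \<longlonglongrightarrow> v" by (auto simp: convergent_def)
    then have "(\<lambda>n. \<Sum>i<n. of_real (g (h i) \<omega>) * a (h i)) \<longlonglongrightarrow> Complex u v"
      by (simp add: tendsto_complex_iff Re_sum Im_sum)
    then show ?case by (auto simp: convergent_def)
  qed
qed

end

text \<open>A symmetric partial sum splits into nonnegative and negative indices, and each half is a
  one-sided series of independent variables.\<close>

lemma AE_convergent_symmetric_series:
  fixes g :: "int \<Rightarrow> 'a \<Rightarrow> real" and a :: "int \<Rightarrow> complex"
  assumes "indep_subgaussian M g c" and a: "(\<lambda>k. (cmod (a k))\<^sup>2) summable_on UNIV"
  shows "AE \<omega> in M. convergent (\<lambda>N. \<Sum>k\<in>{- int N..int N}. of_real (g k \<omega>) * a k)"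
proof -
  interpret indep_subgaussian M g c by fact
  have summ: "summable (\<lambda>n. (cmod (a (h n)))\<^sup>2)" if "inj h" for h :: "nat \<Rightarrow> int"
  proof -
    have "(\<lambda>k. (cmod (a k))\<^sup>2) summable_on range h" using a by (rule summable_on_subset_banach) auto
    then have "((\<lambda>k. (cmod (a k))\<^sup>2) \<circ> h) summable_on UNIV" using that by (subst (asm) summable_on_reindex) auto
    then show ?thesis by (intro summable_on_imp_summable) (simp add: comp_def)
  qed
  have i1: "inj int" and i2: "inj (\<lambda>n. - 1 - int n)" by (auto simp: inj_on_def)
  \<comment> \<open>Index 0 belongs to the first half, which therefore has \<open>Suc N\<close>
    terms against \<open>N\<close> in the second.\<close>
  have split: "(\<Sum>k\<in>{- int N..int N}. u k) = (\<Sum>i<Suc N. u (int i)) + (\<Sum>i<N. u (- 1 - int i))"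
    for N and u :: "int \<Rightarrow> complex"
  proof (induction N)
    case (Suc N)
    have "{- int (Suc N)..int (Suc N)} = insert (int (Suc N)) (insert (- int (Suc N)) {- int N..int N})" by auto
    then show ?case using Suc by (simp add: algebra_simps)
  qed simp
  show ?thesis
    using AE_convergent_series[OF i1 summ[OF i1]] AE_convergent_series[OF i2 summ[OF i2]]
  proof eventually_elim
    case (elim \<omega>)
    have "convergent (\<lambda>N. \<Sum>i<Suc N. of_real (g (int i) \<omega>) * a (int i))"
      using elim(1) by (rule convergent_Suc_iff[THEN iffD2])
    with elim(2) show ?case unfolding split by (intro convergent_add)
  qed
qed

section \<open>Measurability and moments of limits\<close>

lemma lim0_eq: "X \<longlonglongrightarrow> L \<Longrightarrow> lim0 X = L"
  by (auto simp: lim0_def convergent_def limI)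

lemma borel_measurable_lim0 [measurable (raw)]:
  assumes [measurable]: "\<And>n. X n \<in> borel_measurable M"
  shows "(\<lambda>\<omega>. lim0 (\<lambda>n. X n \<omega>)) \<in> borel_measurable M"
  unfolding lim0_def Cauchy_convergent_iff[symmetric] by measurable

lemma tendsto_cmod_powr:
  assumes "X \<longlonglongrightarrow> L" "0 < (r::real)"
  shows "(\<lambda>n. cmod (X n) powr r) \<longlonglongrightarrow> cmod L powr r"
  using assms by (intro tendsto_powr' tendsto_norm) auto

text \<open>This is Fatou's lemma. At points of divergence the default value 0 of
  \<open>lim0\<close> lies below any lower limit, so bounds on the partial sums suffice.\<close>

lemma lim0_moment_le:
  assumes [measurable]: "\<And>n. X n \<in> borel_measurable M" and r: "0 < r"
    and B: "\<And>n. (\<integral>\<^sup>+ \<omega>. ennreal (cmod (X n \<omega>) powr r) \<partial>M) \<le> B"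
  shows "(\<integral>\<^sup>+ \<omega>. ennreal (cmod (lim0 (\<lambda>n. X n \<omega>)) powr r) \<partial>M) \<le> B"
proof -
  have "ennreal (cmod (lim0 Y) powr r) \<le> liminf (\<lambda>n. ennreal (cmod (Y n) powr r))" for Y
  proof (cases "convergent Y")
    case True
    then obtain L where L: "Y \<longlonglongrightarrow> L" by (auto simp: convergent_def)
    then have "(\<lambda>n. ennreal (cmod (Y n) powr r)) \<longlonglongrightarrow> ennreal (cmod L powr r)"
      by (intro tendsto_ennrealI tendsto_cmod_powr r)
    then have "liminf (\<lambda>n. ennreal (cmod (Y n) powr r)) = ennreal (cmod L powr r)"
      by (intro lim_imp_Liminf) auto
    then show ?thesis by (simp add: lim0_eq[OF L])
  qed (simp add: lim0_def)
  then have "(\<integral>\<^sup>+ \<omega>. ennreal (cmod (lim0 (\<lambda>n. X n \<omega>)) powr r) \<partial>M)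
      \<le> (\<integral>\<^sup>+ \<omega>. liminf (\<lambda>n. ennreal (cmod (X n \<omega>) powr r)) \<partial>M)"
    by (intro nn_integral_mono)
  also have "\<dots> \<le> liminf (\<lambda>n. \<integral>\<^sup>+ \<omega>. ennreal (cmod (X n \<omega>) powr r) \<partial>M)"
    by (intro nn_integral_liminf) measurable
  also have "\<dots> \<le> liminf (\<lambda>n. B)" by (intro Liminf_mono always_eventually allI B)
  also have "\<dots> = B" by (simp add: Liminf_const)
  finally show ?thesis .
qed

section \<open>Differences of squared moduli\<close>

text \<open>A pointwise AM-GM inequality with weight \<open>e\<close> takes the place of
  Cauchy-Schwarz: when \<open>A - B\<close> has size \<open>e\<close> and \<open>A\<close>,
  \<open>B\<close> have size 1, both terms on the right have order \<open>e powr r\<close>.\<close>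

lemma diff_square_powr_le:
  fixes A B :: complex
  assumes r: "1 \<le> r" and e: "0 < e"
  shows "\<bar>(cmod A)\<^sup>2 - (cmod B)\<^sup>2\<bar> powr r
    \<le> (4 * e) powr r * (cmod A powr (2 * r) + cmod B powr (2 * r)) + inverse e powr r * cmod (A - B) powr (2 * r)"
proof -
  let ?u = "cmod A + cmod B" and ?v = "cmod (A - B)"
  have sq: "y powr (2 * r) = (y powr r)\<^sup>2" for y :: real
    by (simp add: power2_eq_square powr_add[symmetric])
  have "\<bar>(cmod A)\<^sup>2 - (cmod B)\<^sup>2\<bar> = \<bar>cmod A - cmod B\<bar> * ?u"
    by (simp add: power2_eq_square square_diff_square_factored abs_mult)
  also have "\<dots> \<le> ?v * ?u" by (intro mult_right_mono norm_triangle_ineq3) auto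
  finally have "\<bar>(cmod A)\<^sup>2 - (cmod B)\<^sup>2\<bar> powr r \<le> (?v * ?u) powr r" using r by (intro powr_mono2) auto
  also have "(?v * ?u) powr r = ?u powr r * ?v powr r" by (simp add: powr_mult)
  also have "\<dots> \<le> e powr r * (?u powr r)\<^sup>2 + inverse e powr r * (?v powr r)\<^sup>2"
  proof -
    define p where "p = e powr (r/2)"
    have p: "p > 0" "e powr r = p\<^sup>2" "inverse e powr r = (inverse p)\<^sup>2"
      using e by (simp_all add: p_def power2_eq_square powr_add[symmetric] powr_minus_divide[symmetric]
        inverse_eq_divide powr_divide)
    have am_gm: "\<alpha> * \<beta> \<le> \<alpha>\<^sup>2 + \<beta>\<^sup>2" if "0 \<le> \<alpha>" "0 \<le> \<beta>" for \<alpha> \<beta> :: real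
      using sum_squares_bound[of \<alpha> \<beta>] mult_nonneg_nonneg[OF that] by linarith
    have "?u powr r * ?v powr r = (p * ?u powr r) * (inverse p * ?v powr r)" using p(1) by simp
    also have "\<dots> \<le> (p * ?u powr r)\<^sup>2 + (inverse p * ?v powr r)\<^sup>2" using p(1) by (intro am_gm) auto
    finally show ?thesis unfolding p(2,3) power_mult_distrib .
  qed
  also have "\<dots> = e powr r * ?u powr (2 * r) + inverse e powr r * ?v powr (2 * r)" by (simp only: sq)
  also have "e powr r * ?u powr (2 * r) \<le> e powr r * (2 powr (2 * r) * (cmod A powr (2 * r) + cmod B powr (2 * r)))"
    using r by (intro mult_left_mono powr_add_le) auto
  also have "\<dots> = (4 * e) powr r * (cmod A powr (2 * r) + cmod B powr (2 * r))"
    using e by (simp add: powr_mult powr_powr[symmetric])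
  finally show ?thesis by simp
qed

text \<open>Almost sure convergence is indispensable here: where only one of the two series
  converges, the junk value of \<^const>\<open>lim0\<close> would spoil the smallness of the difference.\<close>
lemma diff_square_moment_le:
  fixes g :: "int \<Rightarrow> 'a \<Rightarrow> real" and a b :: "int \<Rightarrow> complex"
  assumes "indep_subgaussian M g c"
    and a: "\<And>I. finite I \<Longrightarrow> (\<Sum>k\<in>I. (cmod (a k))\<^sup>2) \<le> 1"
    and b: "\<And>I. finite I \<Longrightarrow> (\<Sum>k\<in>I. (cmod (b k))\<^sup>2) \<le> 1"
    and ab: "\<And>I. finite I \<Longrightarrow> (\<Sum>k\<in>I. (cmod (a k - b k))\<^sup>2) \<le> e\<^sup>2"
    and e: "0 < e" and r: "1 \<le> r"
  defines "S \<equiv> \<lambda>u \<omega>. lim0 (\<lambda>N. \<Sum>k\<in>{- int N..int N}. of_real (g k \<omega>) * u k)"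
  shows "(\<integral>\<^sup>+ \<omega>. ennreal (\<bar>(cmod (S a \<omega>))\<^sup>2 - (cmod (S b \<omega>))\<^sup>2\<bar> powr r) \<partial>M)
    \<le> ennreal ((24 * (indep_subgaussian.K c)\<^sup>2 * r * e) powr r)"
proof -
  interpret indep_subgaussian M g c by fact
  have [measurable]: "S u \<in> borel_measurable M" for u unfolding S_def by measurable
  \<comment> \<open>Doubling the exponent squares \<open>sqrt (2 * r)\<close>, so that the bound
    grows linearly in \<open>r\<close> inside the \<open>r\<close>-th power.\<close>
  have mom: "(\<integral>\<^sup>+ \<omega>. ennreal (cmod (S u \<omega>) powr (2 * r)) \<partial>M) \<le> ennreal ((2 * K\<^sup>2 * r) powr r * (s powr r)\<^sup>2)"
    if u: "\<And>I. finite I \<Longrightarrow> (\<Sum>k\<in>I. (cmod (u k))\<^sup>2) \<le> s\<^sup>2" and s: "s > 0" for u s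
  proof -
    have "(\<integral>\<^sup>+ \<omega>. ennreal (cmod (S u \<omega>) powr (2 * r)) \<partial>M) \<le> ennreal ((K * sqrt (2 * r) * s) powr (2 * r))"
      unfolding S_def using r s by (intro lim0_moment_le sum_moment_le u) auto
    also have "(K * sqrt (2 * r) * s) powr (2 * r) = ((K * sqrt (2 * r) * s) powr 2) powr r"
      by (simp add: powr_powr)
    also have "(K * sqrt (2 * r) * s) powr 2 = 2 * K\<^sup>2 * r * (s * s)"
      using r s K_pos by (simp add: powr_numeral power2_eq_square)
    also have "(2 * K\<^sup>2 * r * (s * s)) powr r = (2 * K\<^sup>2 * r) powr r * (s powr r)\<^sup>2"
      using r s by (simp add: powr_mult power2_eq_square)
    finally show ?thesis .
  qed
  have conv: "AE \<omega> in M. convergent (\<lambda>N. \<Sum>k\<in>{- int N..int N}. of_real (g k \<omega>) * u k)"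
    if u: "\<And>I. finite I \<Longrightarrow> (\<Sum>k\<in>I. (cmod (u k))\<^sup>2) \<le> 1" for u :: "int \<Rightarrow> complex"
    by (rule AE_convergent_symmetric_series[OF assms(1)])
       (auto intro!: nonneg_bdd_above_summable_on bdd_aboveI2[where M=1] u)
  have "AE \<omega> in M. convergent (\<lambda>N. \<Sum>k\<in>{- int N..int N}. of_real (g k \<omega>) * a k)"
    "AE \<omega> in M. convergent (\<lambda>N. \<Sum>k\<in>{- int N..int N}. of_real (g k \<omega>) * b k)"
    by (rule conv, fact a, rule conv, fact b)
  then have diff: "AE \<omega> in M. S a \<omega> - S b \<omega> = S (\<lambda>k. a k - b k) \<omega>"
  proof eventually_elim
    case (elim \<omega>)
    then obtain A B where AB: "(\<lambda>N. \<Sum>k\<in>{- int N..int N}. of_real (g k \<omega>) * a k) \<longlonglongrightarrow> A"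
       "(\<lambda>N. \<Sum>k\<in>{- int N..int N}. of_real (g k \<omega>) * b k) \<longlonglongrightarrow> B" by (auto simp: convergent_def)
    from tendsto_diff[OF this]
    have "(\<lambda>N. \<Sum>k\<in>{- int N..int N}. of_real (g k \<omega>) * (a k - b k)) \<longlonglongrightarrow> A - B"
      by (simp add: algebra_simps sum_subtractf)
    with AB show ?case by (simp add: S_def lim0_eq)
  qed
  let ?d = "\<lambda>k. a k - b k" and ?Q = "(2 * K\<^sup>2 * r) powr r"
  have "(\<integral>\<^sup>+ \<omega>. ennreal (\<bar>(cmod (S a \<omega>))\<^sup>2 - (cmod (S b \<omega>))\<^sup>2\<bar> powr r) \<partial>M)
    \<le> (\<integral>\<^sup>+ \<omega>. ennreal ((4 * e) powr r) * (ennreal (cmod (S a \<omega>) powr (2 * r)) + ennreal (cmod (S b \<omega>) powr (2 * r)))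
         + ennreal (inverse e powr r) * ennreal (cmod (S ?d \<omega>) powr (2 * r)) \<partial>M)"
    using diff
  proof (intro nn_integral_mono_AE, eventually_elim)
    case (elim \<omega>)
    from diff_square_powr_le[OF r e, of "S a \<omega>" "S b \<omega>"] show ?case
      unfolding elim
      by (simp add: ennreal_mult[symmetric] ennreal_plus[symmetric] ennreal_leI del: ennreal_plus)
  qed
  also have "\<dots> = ennreal ((4 * e) powr r) * ((\<integral>\<^sup>+ \<omega>. ennreal (cmod (S a \<omega>) powr (2 * r)) \<partial>M) + (\<integral>\<^sup>+ \<omega>. ennreal (cmod (S b \<omega>) powr (2 * r)) \<partial>M))
      + ennreal (inverse e powr r) * (\<integral>\<^sup>+ \<omega>. ennreal (cmod (S ?d \<omega>) powr (2 * r)) \<partial>M)"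
    by (simp add: nn_integral_add nn_integral_cmult)
  \<comment> \<open>The scale \<open>s\<close> is 1 for \<open>a\<close> and \<open>b\<close>, and
    \<open>e\<close> for their difference.\<close>
  also have "\<dots> \<le> ennreal ((4 * e) powr r) * (ennreal (?Q * (1 powr r)\<^sup>2) + ennreal (?Q * (1 powr r)\<^sup>2))
      + ennreal (inverse e powr r) * ennreal (?Q * (e powr r)\<^sup>2)"
    by (intro add_mono mult_left_mono mom) (use a b ab e in auto)
  also have "\<dots> = ennreal ((4 * e) powr r * (?Q + ?Q) + inverse e powr r * (?Q * (e powr r)\<^sup>2))"
    by (simp add: ennreal_mult[symmetric] ennreal_plus[symmetric] del: ennreal_plus)
  also have "(4 * e) powr r * (?Q + ?Q) + inverse e powr r * (?Q * (e powr r)\<^sup>2) = ?Q * e powr r * (2 * 4 powr r + 1)"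
  proof -
    have "inverse e powr r * e powr r = 1" using e by (simp add: powr_mult[symmetric])
    then have "inverse e powr r * (?Q * (e powr r)\<^sup>2) = ?Q * e powr r"
      by (simp add: power2_eq_square mult.left_commute[of "inverse e powr r"])
    then show ?thesis using e by (simp add: powr_mult algebra_simps)
  qed
  \<comment> \<open>The factor is absorbed as \<open>3 powr r * 4 powr r\<close>; with the 2 inside
    \<open>?Q\<close> this produces the constant 24.\<close>
  also have "\<dots> \<le> ?Q * e powr r * 12 powr r"
  proof -
    have "1 \<le> (4::real) powr r" "(3::real) \<le> 3 powr r" using r by (auto intro!: le_powr_of_one_le ge_one_powr_ge_zero)
    then have "2 * 4 powr r + 1 \<le> 3 powr r * (4::real) powr r"
      using mult_right_mono[of 3 "3 powr r" "4 powr r"] by linarith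
    also have "\<dots> = 12 powr r" by (simp add: powr_mult[symmetric])
    finally show ?thesis by (intro mult_left_mono) auto
  qed
  also have "?Q * e powr r * 12 powr r = (24 * K\<^sup>2 * r * e) powr r"
    using e r by (simp add: powr_mult[symmetric] mult_ac)
  finally show ?thesis by (simp add: ennreal_leI)
qed

section \<open>Moments on the product space\<close>

text \<open>At the endpoint \<open>x = 0\<close> the claim reduces to
  \<open>t powr q \<le> t\<close> for \<open>t < 1\<close>; elsewhere it is convexity on the
  positive reals.\<close>

lemma convex_on_powr_nonneg:
  assumes q: "1 \<le> (q::real)"
  shows "convex_on {0..} (\<lambda>x. x powr q)"
proof (rule convex_on_linorderI)
  fix t x y :: real
  assume t: "0 < t" "t < 1" and x: "x \<in> {0..}" "y \<in> {0..}" "x < y"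
  show "((1 - t) *\<^sub>R x + t *\<^sub>R y) powr q \<le> (1 - t) * x powr q + t * y powr q"
  proof (cases "x = 0")
    case True
    have "t powr q \<le> t" using powr_mono'[of 1 q t] t q by simp
    then show ?thesis using True t x by (simp add: powr_mult mult_right_mono)
  next
    case False
    then show ?thesis using convex_onD[OF powr_convex[OF q], of t x y] t x by simp
  qed
qed simp

text \<open>Jensen's inequality for the probability weights \<open>w j * G j / T\<close> at the
  points \<open>y j / G j\<close>. The free scale \<open>G j\<close> will be the expected size of
  \<open>y j\<close>, which makes the points comparable.\<close>

lemma weighted_sum_powr_le:
  fixes w G y :: "'i \<Rightarrow> real"
  assumes J: "finite J" and w: "\<And>j. 0 \<le> w j" and G: "\<And>j. 0 < G j" and y: "\<And>j. 0 \<le> y j" and q: "1 \<le> q"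
  defines "T \<equiv> \<Sum>j\<in>J. w j * G j"
  shows "(\<Sum>j\<in>J. w j * y j) powr q \<le> T powr q * (\<Sum>j\<in>J. w j * G j / T * (y j / G j) powr q)"
proof (cases "T = 0")
  case True
  then have "\<forall>j\<in>J. w j * G j = 0" unfolding T_def
    using J w G by (subst (asm) sum_nonneg_eq_0_iff) (auto simp: less_imp_le)
  then have "\<forall>j\<in>J. w j = 0" using G by (auto simp: less_le)
  then show ?thesis using q by simp
next
  case False
  have T0: "T \<ge> 0" unfolding T_def using w G by (intro sum_nonneg mult_nonneg_nonneg) (auto simp: less_imp_le)
  with False have T: "T > 0" by simp
  then have "J \<noteq> {}" by (auto simp: T_def)
  have "(\<Sum>j\<in>J. w j * y j) = T * (\<Sum>j\<in>J. (w j * G j / T) *\<^sub>R (y j / G j))"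
    unfolding sum_distrib_left using T G by (intro sum.cong) (auto simp: less_imp_neq[symmetric])
  then have "(\<Sum>j\<in>J. w j * y j) powr q = T powr q * (\<Sum>j\<in>J. (w j * G j / T) *\<^sub>R (y j / G j)) powr q"
    using T by (simp add: powr_mult)
  also have "\<dots> \<le> T powr q * (\<Sum>j\<in>J. w j * G j / T * (y j / G j) powr q)"
    using J \<open>J \<noteq> {}\<close> T w G y
    by (intro mult_left_mono convex_on_sum[OF _ _ convex_on_powr_nonneg[OF q]])
       (auto simp: T_def sum_divide_distrib[symmetric] less_imp_le)
  finally show ?thesis .
qed

text \<open>For a fixed first variable the sum is subgaussian in the second, with l2 norm
  \<open>s \<omega>\<close>. Jensen's inequality with weights adapted to \<open>H\<close> then
  reduces the moments of \<open>s\<close> to those of the \<open>d j\<close>.\<close>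

lemma product_moment_le:
  fixes lam :: "nat \<Rightarrow> complex" and d :: "nat \<Rightarrow> 'a \<Rightarrow> real" and g :: "nat \<Rightarrow> 'b \<Rightarrow> real"
  assumes M2: "indep_subgaussian M2 g c"
    and d[measurable]: "\<And>j. d j \<in> borel_measurable M1"
    and dmom: "\<And>j. (\<integral>\<^sup>+ \<omega>. ennreal (\<bar>d j \<omega>\<bar> powr r) \<partial>M1) \<le> ennreal ((D * H j) powr r)"
    and D: "0 \<le> D" and H: "\<And>j. 0 < H j" and r: "2 \<le> r" and \<tau>: "0 \<le> \<tau>"
    and lamH: "(\<Sum>j<n. (cmod (lam j))\<^sup>2 * (H j)\<^sup>2) \<le> \<tau>\<^sup>2"
  shows "(\<integral>\<^sup>+ p. ennreal (cmod (\<Sum>j<n. of_real (g j (snd p)) * (lam j * of_real (d j (fst p)))) powr r) \<partial>(M1 \<Otimes>\<^sub>M M2))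
    \<le> ennreal ((indep_subgaussian.K c * sqrt r * D * \<tau>) powr r)"
proof -
  interpret indep_subgaussian M2 g c by fact
  let ?w = "\<lambda>j. (cmod (lam j))\<^sup>2"
  define T where "T = (\<Sum>j<n. ?w j * (H j)\<^sup>2)"
  define p where "p j = ?w j * (H j)\<^sup>2 / T" for j
  have T0: "0 \<le> T" unfolding T_def by (intro sum_nonneg) auto
  have p0: "0 \<le> p j" for j using T0 by (simp add: p_def)
  \<comment> \<open>The sum is 1, or 0 when \<open>T = 0\<close>, by the convention for division by
    zero.\<close>
  have psum: "(\<Sum>j<n. p j) \<le> 1" by (simp add: p_def sum_divide_distrib[symmetric] flip: T_def)
  define s where "s \<omega> = sqrt (\<Sum>j<n. ?w j * (d j \<omega>)\<^sup>2)" for \<omega>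
  have s0: "0 \<le> s \<omega>" for \<omega> by (auto simp: s_def intro!: sum_nonneg)
  have s2: "(s \<omega>)\<^sup>2 = (\<Sum>j<n. ?w j * (d j \<omega>)\<^sup>2)" for \<omega> by (auto simp: s_def intro!: sum_nonneg)
  have half: "(z\<^sup>2) powr (r / 2) = \<bar>z\<bar> powr r" for z :: real
  proof -
    have "(z\<^sup>2) powr (r / 2) = (\<bar>z\<bar> powr 2) powr (r / 2)" by (simp add: powr_numeral)
    then show ?thesis unfolding powr_powr by simp
  qed
  \<comment> \<open>Jensen's inequality is applied to the squares with exponent
    \<open>r / 2\<close>, which is at least 1 because \<open>r \<ge> 2\<close>.\<close>
  have sr: "s \<omega> powr r \<le> \<tau> powr r * (\<Sum>j<n. p j * inverse (H j) powr r * \<bar>d j \<omega>\<bar> powr r)" for \<omega>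
  proof -
    have "s \<omega> powr r = (\<Sum>j<n. ?w j * (d j \<omega>)\<^sup>2) powr (r / 2)"
      unfolding s2[symmetric] half using s0 by simp
    also have "\<dots> \<le> T powr (r / 2) * (\<Sum>j<n. p j * ((d j \<omega>)\<^sup>2 / (H j)\<^sup>2) powr (r / 2))"
      unfolding T_def p_def using H r by (intro weighted_sum_powr_le zero_less_power) auto
    also have "(\<Sum>j<n. p j * ((d j \<omega>)\<^sup>2 / (H j)\<^sup>2) powr (r / 2)) = (\<Sum>j<n. p j * inverse (H j) powr r * \<bar>d j \<omega>\<bar> powr r)"
    proof (rule sum.cong[OF refl])
      fix j
      have "((d j \<omega>)\<^sup>2 / (H j)\<^sup>2) powr (r / 2) = \<bar>d j \<omega> / H j\<bar> powr r"
        unfolding power_divide[symmetric] half ..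
      also have "\<bar>d j \<omega> / H j\<bar> = inverse (H j) * \<bar>d j \<omega>\<bar>" using H[of j] by (simp add: divide_inverse abs_mult)
      also have "\<dots> powr r = inverse (H j) powr r * \<bar>d j \<omega>\<bar> powr r" using H[of j] by (simp add: powr_mult)
      finally show "p j * ((d j \<omega>)\<^sup>2 / (H j)\<^sup>2) powr (r / 2) = p j * inverse (H j) powr r * \<bar>d j \<omega>\<bar> powr r" by simp
    qed
    also have "T powr (r / 2) * \<dots> \<le> (\<tau>\<^sup>2) powr (r / 2) * \<dots>"
      using T0 lamH r by (intro mult_right_mono powr_mono2 sum_nonneg mult_nonneg_nonneg p0) (auto simp: T_def)
    also have "(\<tau>\<^sup>2) powr (r / 2) = \<tau> powr r" unfolding half using \<tau> by simp
    finally show ?thesis .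
  qed
  have "(\<integral>\<^sup>+ \<omega>. ennreal (s \<omega> powr r) \<partial>M1)
    \<le> (\<integral>\<^sup>+ \<omega>. ennreal (\<tau> powr r) * (\<Sum>j<n. ennreal (p j * inverse (H j) powr r) * ennreal (\<bar>d j \<omega>\<bar> powr r)) \<partial>M1)"
    using sr p0 by (intro nn_integral_mono) (simp add: ennreal_mult[symmetric] sum_nonneg ennreal_leI)
  also have "\<dots> = ennreal (\<tau> powr r) * (\<Sum>j<n. ennreal (p j * inverse (H j) powr r) * (\<integral>\<^sup>+ \<omega>. ennreal (\<bar>d j \<omega>\<bar> powr r) \<partial>M1))"
    by (simp add: nn_integral_cmult nn_integral_sum)
  also have "\<dots> \<le> ennreal (\<tau> powr r) * (\<Sum>j<n. ennreal (p j * inverse (H j) powr r) * ennreal ((D * H j) powr r))"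
    by (intro mult_left_mono sum_mono dmom) auto
  also have "\<dots> = ennreal (\<tau> powr r * (\<Sum>j<n. p j * inverse (H j) powr r * (D * H j) powr r))"
    using p0 by (simp add: ennreal_mult[symmetric] sum_nonneg)
  \<comment> \<open>The scale \<open>H j\<close> cancels, so every index contributes the same
    \<open>D powr r\<close>.\<close>
  also have "(\<Sum>j<n. p j * inverse (H j) powr r * (D * H j) powr r) = D powr r * (\<Sum>j<n. p j)"
    unfolding sum_distrib_left
  proof (rule sum.cong[OF refl])
    fix j
    have "inverse (H j) powr r * (D * H j) powr r = (inverse (H j) * (D * H j)) powr r"
      using H[of j] D by (simp add: powr_mult)
    also have "inverse (H j) * (D * H j) = D" using H[of j] by simp
    finally show "p j * inverse (H j) powr r * (D * H j) powr r = D powr r * p j" by simp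
  qed
  also have "\<tau> powr r * (D powr r * (\<Sum>j<n. p j)) \<le> \<tau> powr r * (D powr r * 1)"
    using psum by (intro mult_left_mono) auto
  finally have smom: "(\<integral>\<^sup>+ \<omega>. ennreal (s \<omega> powr r) \<partial>M1) \<le> ennreal (\<tau> powr r * D powr r)"
    by (simp add: ennreal_leI)
  have "(\<integral>\<^sup>+ p. ennreal (cmod (\<Sum>j<n. of_real (g j (snd p)) * (lam j * of_real (d j (fst p)))) powr r) \<partial>(M1 \<Otimes>\<^sub>M M2))
    = (\<integral>\<^sup>+ \<omega>. \<integral>\<^sup>+ \<omega>'. ennreal (cmod (\<Sum>j<n. of_real (g j \<omega>') * (lam j * of_real (d j \<omega>))) powr r) \<partial>M2 \<partial>M1)"
    by (subst nn_integral_fst[symmetric]) auto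
  also have "\<dots> \<le> (\<integral>\<^sup>+ \<omega>. ennreal ((K * sqrt r * s \<omega>) powr r) \<partial>M1)"
    using r by (intro nn_integral_mono sum_moment_le s0)
      (auto simp: s2 norm_mult power_mult_distrib)
  also have "\<dots> = (\<integral>\<^sup>+ \<omega>. ennreal ((K * sqrt r) powr r) * ennreal (s \<omega> powr r) \<partial>M1)"
    using K_pos r by (intro nn_integral_cong) (simp add: powr_mult s0 ennreal_mult[symmetric])
  also have "\<dots> = ennreal ((K * sqrt r) powr r) * (\<integral>\<^sup>+ \<omega>. ennreal (s \<omega> powr r) \<partial>M1)"
    by (rule nn_integral_cmult) (simp add: s_def)
  also have "\<dots> \<le> ennreal ((K * sqrt r) powr r) * ennreal (\<tau> powr r * D powr r)"
    by (intro mult_left_mono smom) simp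
  also have "\<dots> = ennreal ((K * sqrt r * D * \<tau>) powr r)"
    using K_pos r D \<tau> by (simp add: ennreal_mult[symmetric] powr_mult mult_ac)
  finally show ?thesis .
qed

section \<open>Small times\<close>

text \<open>Nearly all mass of \<open>p\<close> sits on a finite set, where finitely many continuous
  functions vanish at \<open>t = 0\<close>; elsewhere the phase factor is at most 4. The
  neighbourhood of 0 is the same for all \<open>I\<close>.\<close>

lemma eventually_small_phase_defect:
  fixes p \<phi> :: "'i \<Rightarrow> real"
  assumes p: "\<And>k. 0 \<le> p k" and sum: "(p has_sum 1) UNIV" and e: "0 < e"
  shows "\<forall>\<^sub>F t in nhds 0. \<forall>I. finite I \<longrightarrow> (\<Sum>k\<in>I. p k * (cmod (1 - cis (t * \<phi> k)))\<^sup>2) \<le> e"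
proof -
  have le1: "(\<Sum>k\<in>I. p k) \<le> 1" if "finite I" for I
    using has_sum_mono2[OF has_sum_finite[OF that] sum] p by auto
  \<comment> \<open>Missing mass \<open>e / 8\<close> times the factor 4 costs \<open>e / 2\<close>;
    the other half is spent on \<open>A\<close>.\<close>
  have "\<forall>\<^sub>F A in finite_subsets_at_top UNIV. 1 - e / 8 < (\<Sum>k\<in>A. p k)"
    using e by (intro order_tendstoD(1)[OF sum[unfolded has_sum_def]]) simp
  then obtain A where A: "finite A" "1 - e / 8 < (\<Sum>k\<in>A. p k)"
    by (auto simp: eventually_finite_subsets_at_top)
  have "((\<lambda>t. \<Sum>k\<in>A. p k * (cmod (1 - cis (t * \<phi> k)))\<^sup>2)
      \<longlongrightarrow> (\<Sum>k\<in>A. p k * (cmod (1 - cis (0 * \<phi> k)))\<^sup>2)) (nhds 0)"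
    unfolding cis_conv_exp by (intro tendsto_intros filterlim_ident)
  then have "\<forall>\<^sub>F t in nhds 0. (\<Sum>k\<in>A. p k * (cmod (1 - cis (t * \<phi> k)))\<^sup>2) < e / 2"
    using e by (intro order_tendstoD) auto
  then show ?thesis
  proof (rule eventually_mono, intro allI impI)
    fix t :: real and I :: "'i set"
    assume t: "(\<Sum>k\<in>A. p k * (cmod (1 - cis (t * \<phi> k)))\<^sup>2) < e / 2" and I: "finite I"
    have four: "(cmod (1 - cis z))\<^sup>2 \<le> 4" for z
      using power_mono[OF norm_triangle_ineq4[of 1 "cis z"], of 2] by simp
    have "(\<Sum>k\<in>A \<union> I. p k) = (\<Sum>k\<in>A. p k) + (\<Sum>k\<in>I - A. p k)"
      using A I by (subst sum.union_disjoint[symmetric]) auto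
    with le1[of "A \<union> I"] A I have tail: "(\<Sum>k\<in>I - A. p k) \<le> e / 8" by simp
    have "(\<Sum>k\<in>I. p k * (cmod (1 - cis (t * \<phi> k)))\<^sup>2) \<le> (\<Sum>k\<in>A \<union> (I - A). p k * (cmod (1 - cis (t * \<phi> k)))\<^sup>2)"
      using A I p by (intro sum_mono2) auto
    also have "\<dots> = (\<Sum>k\<in>A. p k * (cmod (1 - cis (t * \<phi> k)))\<^sup>2) + (\<Sum>k\<in>I - A. p k * (cmod (1 - cis (t * \<phi> k)))\<^sup>2)"
      using A I by (intro sum.union_disjoint) auto
    also have "(\<Sum>k\<in>I - A. p k * (cmod (1 - cis (t * \<phi> k)))\<^sup>2) \<le> (\<Sum>k\<in>I - A. p k * 4)"
      by (intro sum_mono mult_left_mono four p)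
    also have "\<dots> \<le> e / 2" using tail by (simp add: sum_distrib_right[symmetric])
    finally show "(\<Sum>k\<in>I. p k * (cmod (1 - cis (t * \<phi> k)))\<^sup>2) \<le> e" using t by simp
  qed
qed

section \<open>The moment estimate for \<open>F\<close> and its limit in probability\<close>

theorem theorem1p9:
  fixes M1 :: "'a measure" and M2 :: "'b measure"
    and g1 :: "int \<Rightarrow> 'a \<Rightarrow> real" and g2 :: "nat \<Rightarrow> 'b \<Rightarrow> real"
    and c :: real
    and f :: "nat \<Rightarrow> real \<Rightarrow> complex" and lam :: "nat \<Rightarrow> complex" and x :: real
  assumes P1: "prob_space M1" and P2: "prob_space M2"
    and c_pos: "c > 0"
    and g1_meas: "\<And>k. g1 k \<in> borel_measurable M1"
    and g1_indep: "prob_space.indep_vars M1 (\<lambda>_. borel) g1 UNIV"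
    and g1_int: "\<And>k. integrable M1 (g1 k)"
    and g1_mean: "\<And>k. (\<integral>\<omega>. g1 k \<omega> \<partial>M1) = 0"
    and g1_subg: "\<And>k (\<gamma>::real). (\<integral>\<^sup>+ \<omega>. ennreal (exp (\<gamma> * g1 k \<omega>)) \<partial>M1) \<le> ennreal (exp (c * \<gamma>\<^sup>2))"
    and g2_meas: "\<And>j. g2 j \<in> borel_measurable M2"
    and g2_indep: "prob_space.indep_vars M2 (\<lambda>_. borel) g2 UNIV"
    and g2_int: "\<And>j. integrable M2 (g2 j)"
    and g2_mean: "\<And>j. (\<integral>\<omega>. g2 j \<omega> \<partial>M2) = 0"
    and g2_subg: "\<And>j (\<gamma>::real). (\<integral>\<^sup>+ \<omega>. ennreal (exp (\<gamma> * g2 j \<omega>)) \<partial>M2) \<le> ennreal (exp (c * \<gamma>\<^sup>2))"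
    and f_meas: "\<And>j. f j \<in> borel_measurable lborel"
    and f_L2: "\<And>j. set_integrable lborel {0..<2*pi} (\<lambda>y. (cmod (f j y))\<^sup>2)"
    and f_orth: "\<And>j l. inner_T (f j) (f l) = (if j = l then 1 else 0)"
    and f_coeff: "\<And>j. ((\<lambda>k. (cmod (fourier_coeff (f j) k))\<^sup>2) has_sum 1) UNIV"
    and lam_l2: "summable (\<lambda>j. (cmod (lam j))\<^sup>2)"
    and x_T: "x \<in> {0..<2*pi}"
  shows "\<exists>C>0. \<forall>\<epsilon>::real. 0 < \<epsilon> \<and> \<epsilon> < 1 \<longrightarrow>
     (let S2 = sqrt (\<Sum>j. (cmod (lam j))\<^sup>2);
          F = (\<lambda>t \<omega> \<omega>'. series0 (\<lambda>j. lam j * complex_of_real (g2 j \<omega>')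
                 * complex_of_real ((cmod (rand_prop g1 (f j) 0 x \<omega>))\<^sup>2
                                    - (cmod (rand_prop g1 (f j) t x \<omega>))\<^sup>2)));
          \<alpha>2 = (S2 + 1) * exp 1 * sqrt \<epsilon> * (\<epsilon> * ln (1 / \<epsilon>)) powr (3/2)
      in (\<exists>\<delta>>0. \<forall>t r. \<bar>t\<bar> < \<delta> \<and> r \<ge> 2 \<longrightarrow>
             (\<integral>\<^sup>+ p. ennreal ((cmod (F t (fst p) (snd p))) powr r) \<partial>(M1 \<Otimes>\<^sub>M M2))
               \<le> ennreal ((C * r powr (3/2) * \<epsilon>\<^sup>2 * (S2 + 1)) powr r))
         \<and> ((\<lambda>t. measure (M1 \<Otimes>\<^sub>M M2)
                 {p \<in> space (M1 \<Otimes>\<^sub>M M2). cmod (F t (fst p) (snd p)) > C * \<alpha>2})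
             \<longlongrightarrow> 0) (at 0))"
proof -
  interpret G1: indep_subgaussian M1 g1 c
    using P1 g1_indep g1_mean g1_subg c_pos
    by (auto simp: indep_subgaussian_def indep_subgaussian_axioms_def)
  interpret G2: indep_subgaussian M2 g2 c
    using P2 g2_indep g2_mean g2_subg c_pos
    by (auto simp: indep_subgaussian_def indep_subgaussian_axioms_def)
  interpret P: pair_prob_space M1 M2 ..
  define w where "w j = (cmod (lam j))\<^sup>2" for j
  define S2 where "S2 = sqrt (\<Sum>j. w j)"
  define K where "K = G2.K"
  have K: "K > 0" by (simp add: K_def G2.K_pos)
  \<comment> \<open>\<open>24 * K\<^sup>2\<close> comes from the difference of squared moduli, the
    third \<open>K\<close> from the randomisation in the second variable.\<close>
  define C where "C = 24 * K ^ 3"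
  have C: "C > 0" using K by (simp add: C_def)
  define \<phi> where "\<phi> k = sqrt (of_int k ^ 4 + of_int k ^ 2)" for k :: int
  \<comment> \<open>With the phases put into the coefficients, time enters only through unimodular
    factors.\<close>
  define a where "a t j k = cis (x * of_int k) * cis (t * \<phi> k) * fourier_coeff (f j) k" for t j k
  define d where "d t j \<omega> = (cmod (rand_prop g1 (f j) 0 x \<omega>))\<^sup>2 - (cmod (rand_prop g1 (f j) t x \<omega>))\<^sup>2" for t j \<omega>
  define F where "F t p = series0 (\<lambda>j. lam j * complex_of_real (g2 j (snd p)) * complex_of_real (d t j (fst p)))" for t p
  have w: "summable w" "\<And>j. 0 \<le> w j" using lam_l2 by (auto simp: w_def[abs_def])
  have S2: "S2 \<ge> 0" "S2\<^sup>2 = (\<Sum>j. w j)" using w by (auto simp: S2_def suminf_nonneg)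
  have rp: "rand_prop g1 (f j) t x \<omega> = lim0 (\<lambda>N. \<Sum>k\<in>{- int N..int N}. of_real (g1 k \<omega>) * a t j k)" for t j \<omega>
    by (simp add: rand_prop_def a_def \<phi>_def mult.assoc)
  have rpm[measurable]: "(\<lambda>\<omega>. rand_prop g1 (f j) t x \<omega>) \<in> borel_measurable M1" for j t
    unfolding rp by measurable
  have dm[measurable]: "d t j \<in> borel_measurable M1" for t j unfolding d_def by measurable
  have Fm[measurable]: "F t \<in> borel_measurable (M1 \<Otimes>\<^sub>M M2)" for t
    unfolding F_def series0_def by measurable
  have a1: "(\<Sum>k\<in>I. (cmod (a t j k))\<^sup>2) \<le> 1" if "finite I" for t j I
  proof -
    have "(\<Sum>k\<in>I. (cmod (a t j k))\<^sup>2) = (\<Sum>k\<in>I. (cmod (fourier_coeff (f j) k))\<^sup>2)"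
      by (simp add: a_def norm_mult)
    also have "\<dots> \<le> 1" using has_sum_mono2[OF has_sum_finite[OF that] f_coeff[of j]] by auto
    finally show ?thesis .
  qed
  have adiff: "(cmod (a 0 j k - a t j k))\<^sup>2 = (cmod (fourier_coeff (f j) k))\<^sup>2 * (cmod (1 - cis (t * \<phi> k)))\<^sup>2" for t j k
  proof -
    have "a 0 j k - a t j k = cis (x * of_int k) * (1 - cis (t * \<phi> k)) * fourier_coeff (f j) k"
      by (simp add: a_def algebra_simps)
    then show ?thesis by (simp add: norm_mult power_mult_distrib)
  qed
  \<comment> \<open>The level \<open>\<kappa>\<close> stays free: \<open>\<epsilon>\<^sup>2\<close>
    gives the moment bound, arbitrarily small levels give the limit in probability. The
    neighbourhood of 0 is fixed before \<open>r\<close> and serves all \<open>r\<close>.\<close>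
  have key: "\<forall>\<^sub>F t in nhds 0. \<forall>r\<ge>2. (\<integral>\<^sup>+ p. ennreal (cmod (F t p) powr r) \<partial>(M1 \<Otimes>\<^sub>M M2))
      \<le> ennreal ((C * r powr (3/2) * \<kappa> * (S2 + 1)) powr r)" if \<kappa>: "\<kappa> > 0" for \<kappa>
  proof -
    have "\<forall>\<^sub>F N in sequentially. (\<Sum>j. w (j + N)) < \<kappa>\<^sup>2 / 4"
      using \<kappa> by (intro order_tendstoD(2)[OF suminf_exist_split2[OF w(1)]]) simp
    then obtain N where N: "(\<Sum>j. w (j + N)) < \<kappa>\<^sup>2 / 4"
      unfolding eventually_sequentially by blast
    \<comment> \<open>Small \<open>t\<close> controls finitely many indices; for the others the
      trivial bound 2 is used, and its square 4 is compensated by the tail of \<open>w\<close> below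
      \<open>\<kappa>\<^sup>2 / 4\<close>.\<close>
    define H where "H j = (if j < N then \<kappa> else 2)" for j
    have H: "H j > 0" for j using \<kappa> by (simp add: H_def)
    have wN: "summable (\<lambda>j. w (j + N))" using w(1) by (rule summable_ignore_initial_segment)
    have lamH: "(\<Sum>j<n. w j * (H j)\<^sup>2) \<le> (\<kappa> * (S2 + 1))\<^sup>2" for n
    proof -
      have "(\<Sum>j<n. w j * (H j)\<^sup>2) \<le> (\<Sum>j<n + N. w j * (H j)\<^sup>2)"
        using w by (intro sum_mono2) auto
      also have "\<dots> = (\<Sum>j<N. w j * (H j)\<^sup>2) + (\<Sum>j<n. w (j + N) * (H (j + N))\<^sup>2)"
        by (induction n) auto
      also have "\<dots> = (\<Sum>j<N. w j) * \<kappa>\<^sup>2 + (\<Sum>j<n. w (j + N)) * 4"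
        by (simp add: H_def sum_distrib_right)
      \<comment> \<open>The tail contributes \<open>\<kappa>\<^sup>2\<close>, which is what the
        \<open>+ 1\<close> in \<open>S2 + 1\<close> pays for.\<close>
      also have "\<dots> \<le> S2\<^sup>2 * \<kappa>\<^sup>2 + \<kappa>\<^sup>2 / 4 * 4"
      proof (intro add_mono mult_right_mono)
        show "(\<Sum>j<N. w j) \<le> S2\<^sup>2" unfolding S2 by (intro sum_le_suminf w) auto
        have "(\<Sum>j<n. w (j + N)) \<le> (\<Sum>j. w (j + N))" by (intro sum_le_suminf w wN) auto
        with N show "(\<Sum>j<n. w (j + N)) \<le> \<kappa>\<^sup>2 / 4" by linarith
      qed auto
      also have "\<dots> \<le> (\<kappa> * (S2 + 1))\<^sup>2"
        using S2(1) by (simp add: power2_eq_square algebra_simps)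
      finally show ?thesis .
    qed
    have "\<forall>\<^sub>F t in nhds 0. \<forall>j\<in>{..<N}. \<forall>I. finite I \<longrightarrow>
        (\<Sum>k\<in>I. (cmod (fourier_coeff (f j) k))\<^sup>2 * (cmod (1 - cis (t * \<phi> k)))\<^sup>2) \<le> \<kappa>\<^sup>2"
      using \<kappa> by (intro eventually_ball_finite ballI eventually_small_phase_defect f_coeff) auto
    then show ?thesis
    proof (rule eventually_mono, intro allI impI)
      fix t r :: real
      assume t: "\<forall>j\<in>{..<N}. \<forall>I. finite I \<longrightarrow>
        (\<Sum>k\<in>I. (cmod (fourier_coeff (f j) k))\<^sup>2 * (cmod (1 - cis (t * \<phi> k)))\<^sup>2) \<le> \<kappa>\<^sup>2"
        and r: "2 \<le> r"
      have aH: "(\<Sum>k\<in>I. (cmod (a 0 j k - a t j k))\<^sup>2) \<le> (H j)\<^sup>2" if I: "finite I" for j I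
      proof (cases "j < N")
        case True
        then show ?thesis using t I by (simp add: adiff H_def)
      next
        case False
        have "(\<Sum>k\<in>I. (cmod (a 0 j k - a t j k))\<^sup>2) \<le> (\<Sum>k\<in>I. 2 * (cmod (a 0 j k))\<^sup>2 + 2 * (cmod (a t j k))\<^sup>2)"
        proof (rule sum_mono)
          fix k
          have "(cmod (a 0 j k - a t j k))\<^sup>2 \<le> (cmod (a 0 j k) + cmod (a t j k))\<^sup>2"
            by (intro power_mono norm_triangle_ineq4) auto
          also have "\<dots> \<le> 2 * (cmod (a 0 j k))\<^sup>2 + 2 * (cmod (a t j k))\<^sup>2"
            using sum_squares_bound[of "cmod (a 0 j k)" "cmod (a t j k)"] by (simp add: power2_sum)
          finally show "(cmod (a 0 j k - a t j k))\<^sup>2 \<le> 2 * (cmod (a 0 j k))\<^sup>2 + 2 * (cmod (a t j k))\<^sup>2" .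
        qed
        \<comment> \<open>Both coefficient families have square sum at most 1, so the total is at
          most the square of \<open>H j = 2\<close>.\<close>
        also have "\<dots> \<le> 4"
          using a1[OF I, of 0 j] a1[OF I, of t j] by (simp add: sum.distrib sum_distrib_left[symmetric])
        finally show ?thesis using False by (simp add: H_def)
      qed
      have dmom: "(\<integral>\<^sup>+ \<omega>. ennreal (\<bar>d t j \<omega>\<bar> powr r) \<partial>M1) \<le> ennreal ((24 * K\<^sup>2 * r * H j) powr r)" for j
        unfolding d_def rp K_def
        by (rule diff_square_moment_le[OF G1.indep_subgaussian_axioms a1 a1 aH H]) (use r in auto)
      have "(\<integral>\<^sup>+ p. ennreal (cmod (F t p) powr r) \<partial>(M1 \<Otimes>\<^sub>M M2))
         = (\<integral>\<^sup>+ p. ennreal (cmod (lim0 (\<lambda>n. \<Sum>j<n. of_real (g2 j (snd p)) * (lam j * of_real (d t j (fst p))))) powr r) \<partial>(M1 \<Otimes>\<^sub>M M2))"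
        by (simp add: F_def series0_def mult_ac)
      \<comment> \<open>Fatou's lemma passes from partial sums in \<open>j\<close> to
        \<open>F\<close>. The powers 1/2 and 1 of \<open>r\<close> from the two randomisations add
        up to 3/2.\<close>
      also have "\<dots> \<le> ennreal ((K * sqrt r * (24 * K\<^sup>2 * r) * (\<kappa> * (S2 + 1))) powr r)"
      proof (rule lim0_moment_le)
        show "(\<integral>\<^sup>+ p. ennreal (cmod (\<Sum>j<n. of_real (g2 j (snd p)) * (lam j * of_real (d t j (fst p)))) powr r) \<partial>(M1 \<Otimes>\<^sub>M M2))
          \<le> ennreal ((K * sqrt r * (24 * K\<^sup>2 * r) * (\<kappa> * (S2 + 1))) powr r)" for n
          unfolding K_def
          by (rule product_moment_le[OF G2.indep_subgaussian_axioms dm dmom[unfolded K_def] _ H r _ lamH[unfolded w_def]])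
             (use r \<kappa> S2 in auto)
      qed (use r in auto)
      also have "K * sqrt r * (24 * K\<^sup>2 * r) * (\<kappa> * (S2 + 1)) = C * r powr (3/2) * \<kappa> * (S2 + 1)"
      proof -
        have "r powr (3/2) = r powr (1 + 1/2)" by simp
        also have "\<dots> = r * sqrt r" unfolding powr_add using r by (simp add: powr_half_sqrt)
        finally show ?thesis by (simp add: C_def power3_eq_cube power2_eq_square)
      qed
      finally show "(\<integral>\<^sup>+ p. ennreal (cmod (F t p) powr r) \<partial>(M1 \<Otimes>\<^sub>M M2))
        \<le> ennreal ((C * r powr (3/2) * \<kappa> * (S2 + 1)) powr r)" .
    qed
  qed
  have prob: "((\<lambda>t. measure (M1 \<Otimes>\<^sub>M M2) {p \<in> space (M1 \<Otimes>\<^sub>M M2). cmod (F t p) > \<beta>}) \<longlongrightarrow> 0) (at 0)"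
    if \<beta>: "\<beta> > 0" for \<beta>
  proof (rule tendstoI)
    fix e :: real assume e: "e > 0"
    define Q where "Q = C * 2 powr (3/2) * (S2 + 1)"
    have Q: "Q > 0" using C S2 by (simp add: Q_def add_nonneg_pos)
    \<comment> \<open>This level makes \<open>(Q * \<kappa>)\<^sup>2\<close> equal to
      \<open>\<beta>\<^sup>2 * (e / 2)\<close>, so Chebyshev's inequality leaves probability at most
      \<open>e / 2\<close>.\<close>
    define \<kappa> where "\<kappa> = \<beta> * sqrt (e / 2) / Q"
    have \<kappa>: "\<kappa> > 0" using \<beta> e Q by (simp add: \<kappa>_def)
    have "\<forall>\<^sub>F t in at 0. \<forall>r\<ge>2. (\<integral>\<^sup>+ p. ennreal (cmod (F t p) powr r) \<partial>(M1 \<Otimes>\<^sub>M M2))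
      \<le> ennreal ((C * r powr (3/2) * \<kappa> * (S2 + 1)) powr r)"
      using key[OF \<kappa>] by (simp add: eventually_nhds_conv_at)
    then show "\<forall>\<^sub>F t in at 0. dist (measure (M1 \<Otimes>\<^sub>M M2) {p \<in> space (M1 \<Otimes>\<^sub>M M2). cmod (F t p) > \<beta>}) 0 < e"
    proof (rule eventually_mono)
      fix t
      let ?A = "{p \<in> space (M1 \<Otimes>\<^sub>M M2). cmod (F t p) > \<beta>}"
      assume "\<forall>r\<ge>2. (\<integral>\<^sup>+ p. ennreal (cmod (F t p) powr r) \<partial>(M1 \<Otimes>\<^sub>M M2))
      \<le> ennreal ((C * r powr (3/2) * \<kappa> * (S2 + 1)) powr r)"
      then have "(\<integral>\<^sup>+ p. ennreal (cmod (F t p) powr 2) \<partial>(M1 \<Otimes>\<^sub>M M2))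
        \<le> ennreal ((C * 2 powr (3/2) * \<kappa> * (S2 + 1)) powr 2)" by (rule allE[of _ 2]) simp
      also have "C * 2 powr (3/2) * \<kappa> * (S2 + 1) = Q * \<kappa>" by (simp add: Q_def)
      also have "(Q * \<kappa>) powr 2 = \<beta>\<^sup>2 * (e / 2)" using Q \<beta> e by (simp add: \<kappa>_def powr_numeral power_mult_distrib)
      finally have mom: "(\<integral>\<^sup>+ p. ennreal (cmod (F t p) powr 2) \<partial>(M1 \<Otimes>\<^sub>M M2)) \<le> ennreal (\<beta>\<^sup>2 * (e / 2))" .
      have "emeasure (M1 \<Otimes>\<^sub>M M2) ?A = (\<integral>\<^sup>+ p. indicator ?A p \<partial>(M1 \<Otimes>\<^sub>M M2))"
        by (intro nn_integral_indicator[symmetric]) measurable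
      also have "\<dots> \<le> (\<integral>\<^sup>+ p. ennreal (inverse (\<beta>\<^sup>2)) * ennreal (cmod (F t p) powr 2) \<partial>(M1 \<Otimes>\<^sub>M M2))"
      proof (intro nn_integral_mono)
        fix p
        have "1 \<le> inverse (\<beta>\<^sup>2) * (cmod (F t p))\<^sup>2" if "\<beta> < cmod (F t p)"
          using power_mono[of \<beta> "cmod (F t p)" 2] that \<beta> by (simp add: field_simps)
        then show "indicator ?A p \<le> ennreal (inverse (\<beta>\<^sup>2)) * ennreal (cmod (F t p) powr 2)"
          by (auto simp: indicator_def ennreal_mult[symmetric] powr_numeral simp del: inverse_eq_divide)
      qed
      also have "\<dots> = ennreal (inverse (\<beta>\<^sup>2)) * (\<integral>\<^sup>+ p. ennreal (cmod (F t p) powr 2) \<partial>(M1 \<Otimes>\<^sub>M M2))"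
        by (rule nn_integral_cmult) measurable
      also have "\<dots> \<le> ennreal (inverse (\<beta>\<^sup>2)) * ennreal (\<beta>\<^sup>2 * (e / 2))" by (intro mult_left_mono mom) simp
      also have "\<dots> = ennreal (e / 2)" using \<beta> e by (simp add: ennreal_mult[symmetric])
      finally have "measure (M1 \<Otimes>\<^sub>M M2) ?A \<le> e / 2"
        using e by (simp add: P.emeasure_eq_measure)
      then show "dist (measure (M1 \<Otimes>\<^sub>M M2) ?A) 0 < e" using e by (simp add: dist_real_def)
    qed
  qed
  show ?thesis
    unfolding Let_def
  proof (rule exI[of _ C], intro conjI C allI impI)
    fix \<epsilon> :: real assume \<epsilon>: "0 < \<epsilon> \<and> \<epsilon> < 1"
    then have "\<epsilon>\<^sup>2 > 0" by simp
    from key[OF this] obtain \<delta> where "\<delta> > 0" and \<delta>: "\<And>t r. \<bar>t\<bar> < \<delta> \<Longrightarrow> 2 \<le> r \<Longrightarrow>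
      (\<integral>\<^sup>+ p. ennreal (cmod (F t p) powr r) \<partial>(M1 \<Otimes>\<^sub>M M2))
      \<le> ennreal ((C * r powr (3/2) * \<epsilon>\<^sup>2 * (S2 + 1)) powr r)"
      by (auto simp: eventually_nhds_metric dist_real_def)
    then show "\<exists>\<delta>>0. \<forall>t r. \<bar>t\<bar> < \<delta> \<and> r \<ge> 2 \<longrightarrow>
      (\<integral>\<^sup>+ p. ennreal ((cmod (series0 (\<lambda>j. lam j * complex_of_real (g2 j (snd p))
                 * complex_of_real ((cmod (rand_prop g1 (f j) 0 x (fst p)))\<^sup>2
                                    - (cmod (rand_prop g1 (f j) t x (fst p)))\<^sup>2)))) powr r) \<partial>(M1 \<Otimes>\<^sub>M M2))
               \<le> ennreal ((C * r powr (3/2) * \<epsilon>\<^sup>2 * (sqrt (\<Sum>j. (cmod (lam j))\<^sup>2) + 1)) powr r)"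
      unfolding F_def d_def S2_def w_def by blast
    \<comment> \<open>For \<open>\<epsilon> < 1\<close> the logarithm is positive, so the threshold
      is a fixed positive number.\<close>
    have "ln (1 / \<epsilon>) > 0" using \<epsilon> by simp
    then have "C * ((S2 + 1) * exp 1 * sqrt \<epsilon> * (\<epsilon> * ln (1 / \<epsilon>)) powr (3/2)) > 0"
      using \<epsilon> C S2 by (intro mult_pos_pos) auto
    from prob[OF this]
    show "((\<lambda>t. measure (M1 \<Otimes>\<^sub>M M2) {p \<in> space (M1 \<Otimes>\<^sub>M M2).
         cmod (series0 (\<lambda>j. lam j * complex_of_real (g2 j (snd p))
                 * complex_of_real ((cmod (rand_prop g1 (f j) 0 x (fst p)))\<^sup>2
                                    - (cmod (rand_prop g1 (f j) t x (fst p)))\<^sup>2)))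
         > C * ((sqrt (\<Sum>j. (cmod (lam j))\<^sup>2) + 1) * exp 1 * sqrt \<epsilon> * (\<epsilon> * ln (1 / \<epsilon>)) powr (3/2))})
      \<longlongrightarrow> 0) (at 0)"
      unfolding F_def d_def S2_def w_def .
  qed
qed

end
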